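(* Let $R$ be a semilocal ring. For a right $R$-module $M$, let $S'$ be the sum of all simple direct summands of $M$. The following are equivalent. (1) $M$ is simple-direct-injective. (2) $S'$ is a fully invariant and pure submodule of $M$. (3) $M=S'\oplus N$ for some submodule $N$ of $M$, and $S'$ is a fully invariant submodule of $M$.
   Context: Rings are associative with unity and modules are unitary. $R$ is semilocal if $R/J(R)$ is semisimple Artinian, where $J(R)$ is the Jacobson radical of $R$. A right module $M$ is simple-direct-injective if, whenever $A$ and $B$ are simple submodules of $M$ with $A\cong B$ and $B$ a direct summand of $M$, then $A$ is a direct summand of $M$. A simple direct summand of $M$ is a simple submodule of $M$ that is a direct summand of $M$ (the sum is $0$ if there are none). A submodule $A$ of a right module $B$ is pure if for every left $R$-module $L$ the map $A\otimes_R L\to B\otimes_R L$ induced by inclusion is a monomorphism. A submodule is fully invariant if it is mapped into itself by every endomorphism of $M$. *)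

theory Defs
  imports "HOL-Algebra.QuotRing" "HOL-Algebra.Module" "HOL-Algebra.Free_Abelian_Groups"
begin

section \<open>One-sided modules over a not necessarily commutative ring\<close>

text \<open>
  The library locale \<open>module\<close> requires a commutative ring, but the record type \<open>module\<close> and the
  locale \<open>submodule\<close> do not, and both are reused here for left and for right modules.  The fields
  \<open>mult\<close> and \<open>one\<close> of the record play no role.

  For a right module, \<open>a \<odot>\<^bsub>M\<^esub> x\<close> stands for the product of \<open>x\<close> by \<open>a\<close> on the right; this is
  visible only in the associativity law.
\<close>

locale left_module = R?: ring R + M?: abelian_group M for R (structure) and M (structure) +
  assumes smult_closed:
      "\<lbrakk>a \<in> carrier R; x \<in> carrier M\<rbrakk> \<Longrightarrow> a \<odot>\<^bsub>M\<^esub> x \<in> carrier M"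
    and smult_l_distr:
      "\<lbrakk>a \<in> carrier R; b \<in> carrier R; x \<in> carrier M\<rbrakk> \<Longrightarrow>
        (a \<oplus> b) \<odot>\<^bsub>M\<^esub> x = a \<odot>\<^bsub>M\<^esub> x \<oplus>\<^bsub>M\<^esub> b \<odot>\<^bsub>M\<^esub> x"
    and smult_r_distr:
      "\<lbrakk>a \<in> carrier R; x \<in> carrier M; y \<in> carrier M\<rbrakk> \<Longrightarrow>
        a \<odot>\<^bsub>M\<^esub> (x \<oplus>\<^bsub>M\<^esub> y) = a \<odot>\<^bsub>M\<^esub> x \<oplus>\<^bsub>M\<^esub> a \<odot>\<^bsub>M\<^esub> y"
    and smult_assoc:
      "\<lbrakk>a \<in> carrier R; b \<in> carrier R; x \<in> carrier M\<rbrakk> \<Longrightarrow>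
        (a \<otimes> b) \<odot>\<^bsub>M\<^esub> x = a \<odot>\<^bsub>M\<^esub> (b \<odot>\<^bsub>M\<^esub> x)"
    and smult_one:
      "x \<in> carrier M \<Longrightarrow> \<one> \<odot>\<^bsub>M\<^esub> x = x"

locale right_module = R?: ring R + M?: abelian_group M for R (structure) and M (structure) +
  assumes smult_closed:
      "\<lbrakk>a \<in> carrier R; x \<in> carrier M\<rbrakk> \<Longrightarrow> a \<odot>\<^bsub>M\<^esub> x \<in> carrier M"
    and smult_l_distr:
      "\<lbrakk>a \<in> carrier R; b \<in> carrier R; x \<in> carrier M\<rbrakk> \<Longrightarrow>
        (a \<oplus> b) \<odot>\<^bsub>M\<^esub> x = a \<odot>\<^bsub>M\<^esub> x \<oplus>\<^bsub>M\<^esub> b \<odot>\<^bsub>M\<^esub> x"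
    and smult_r_distr:
      "\<lbrakk>a \<in> carrier R; x \<in> carrier M; y \<in> carrier M\<rbrakk> \<Longrightarrow>
        a \<odot>\<^bsub>M\<^esub> (x \<oplus>\<^bsub>M\<^esub> y) = a \<odot>\<^bsub>M\<^esub> x \<oplus>\<^bsub>M\<^esub> a \<odot>\<^bsub>M\<^esub> y"
    and smult_assoc:
      "\<lbrakk>a \<in> carrier R; b \<in> carrier R; x \<in> carrier M\<rbrakk> \<Longrightarrow>
        (a \<otimes> b) \<odot>\<^bsub>M\<^esub> x = b \<odot>\<^bsub>M\<^esub> (a \<odot>\<^bsub>M\<^esub> x)"
    and smult_one:
      "x \<in> carrier M \<Longrightarrow> \<one> \<odot>\<^bsub>M\<^esub> x = x"

definition mod_hom ::
    "('r, 'x) ring_scheme \<Rightarrow> ('r, 'm, 'y) module_scheme \<Rightarrow> ('r, 'n, 'z) module_scheme \<Rightarrow> ('m \<Rightarrow> 'n) set" where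
  "mod_hom R M N = {f \<in> carrier M \<rightarrow> carrier N.
     (\<forall>x \<in> carrier M. \<forall>y \<in> carrier M. f (x \<oplus>\<^bsub>M\<^esub> y) = f x \<oplus>\<^bsub>N\<^esub> f y) \<and>
     (\<forall>a \<in> carrier R. \<forall>x \<in> carrier M. f (a \<odot>\<^bsub>M\<^esub> x) = a \<odot>\<^bsub>N\<^esub> f x)}"

definition mod_isomorphic ::
    "('r, 'x) ring_scheme \<Rightarrow> ('r, 'm, 'y) module_scheme \<Rightarrow> ('r, 'n, 'z) module_scheme \<Rightarrow> bool" where
  "mod_isomorphic R M N \<longleftrightarrow> (\<exists>f \<in> mod_hom R M N. bij_betw f (carrier M) (carrier N))"

definition simple_submodule ::
    "('r, 'x) ring_scheme \<Rightarrow> ('r, 'm, 'y) module_scheme \<Rightarrow> 'm set \<Rightarrow> bool" where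
  "simple_submodule R M A \<longleftrightarrow>
     submodule A R M \<and> A \<noteq> {\<zero>\<^bsub>M\<^esub>} \<and>
     (\<forall>B. submodule B R M \<and> B \<subseteq> A \<longrightarrow> B = {\<zero>\<^bsub>M\<^esub>} \<or> B = A)"

definition internal_direct_sum ::
    "('r, 'x) ring_scheme \<Rightarrow> ('r, 'm, 'y) module_scheme \<Rightarrow> 'm set \<Rightarrow> 'm set \<Rightarrow> bool" where
  "internal_direct_sum R M A N \<longleftrightarrow>
     submodule A R M \<and> submodule N R M \<and> A <+>\<^bsub>M\<^esub> N = carrier M \<and> A \<inter> N = {\<zero>\<^bsub>M\<^esub>}"

definition direct_summand ::
    "('r, 'x) ring_scheme \<Rightarrow> ('r, 'm, 'y) module_scheme \<Rightarrow> 'm set \<Rightarrow> bool" where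
  "direct_summand R M A \<longleftrightarrow> (\<exists>N. internal_direct_sum R M A N)"

text \<open>The sum of a family of submodules is the additive subgroup generated by their union; it is
  \<open>{\<zero>\<^bsub>M\<^esub>}\<close> for the empty family.\<close>

definition submodule_sum :: "('r, 'm, 'y) module_scheme \<Rightarrow> 'm set set \<Rightarrow> 'm set" where
  "submodule_sum M F = generate (add_monoid M) (\<Union>F)"

definition simple_summand_sum ::
    "('r, 'x) ring_scheme \<Rightarrow> ('r, 'm, 'y) module_scheme \<Rightarrow> 'm set" where
  "simple_summand_sum R M = submodule_sum M {A. simple_submodule R M A \<and> direct_summand R M A}"

definition simple_direct_injective ::
    "('r, 'x) ring_scheme \<Rightarrow> ('r, 'm, 'y) module_scheme \<Rightarrow> bool" where
  "simple_direct_injective R M \<longleftrightarrow>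
     (\<forall>A B. simple_submodule R M A \<and> simple_submodule R M B \<and>
        mod_isomorphic R (M\<lparr>carrier := A\<rparr>) (M\<lparr>carrier := B\<rparr>) \<and> direct_summand R M B
        \<longrightarrow> direct_summand R M A)"

definition fully_invariant ::
    "('r, 'x) ring_scheme \<Rightarrow> ('r, 'm, 'y) module_scheme \<Rightarrow> 'm set \<Rightarrow> bool" where
  "fully_invariant R M A \<longleftrightarrow> submodule A R M \<and> (\<forall>f \<in> mod_hom R M M. f ` A \<subseteq> A)"


section \<open>Semilocal rings\<close>

definition right_regular :: "('r, 'x) ring_scheme \<Rightarrow> ('r, 'r) module" where
  "right_regular R = \<lparr>carrier = carrier R, mult = mult R, one = one R, ring.zero = \<zero>\<^bsub>R\<^esub>, ring.add = add R,
     smult = (\<lambda>a x. x \<otimes>\<^bsub>R\<^esub> a)\<rparr>"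

definition maximal_right_ideal :: "('r, 'x) ring_scheme \<Rightarrow> 'r set \<Rightarrow> bool" where
  "maximal_right_ideal R I \<longleftrightarrow>
     submodule I R (right_regular R) \<and> I \<noteq> carrier R \<and>
     (\<forall>K. submodule K R (right_regular R) \<and> I \<subseteq> K \<longrightarrow> K = I \<or> K = carrier R)"

definition jacobson_radical :: "('r, 'x) ring_scheme \<Rightarrow> 'r set" where
  "jacobson_radical R = carrier R \<inter> \<Inter>{I. maximal_right_ideal R I}"

definition semisimple_module ::
    "('r, 'x) ring_scheme \<Rightarrow> ('r, 'm, 'y) module_scheme \<Rightarrow> bool" where
  "semisimple_module R M \<longleftrightarrow> submodule_sum M {A. simple_submodule R M A} = carrier M"

definition artinian_module ::
    "('r, 'x) ring_scheme \<Rightarrow> ('r, 'm, 'y) module_scheme \<Rightarrow> bool" where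
  "artinian_module R M \<longleftrightarrow>
     (\<forall>K :: nat \<Rightarrow> 'm set. (\<forall>n. submodule (K n) R M \<and> K (Suc n) \<subseteq> K n)
        \<longrightarrow> (\<exists>n. \<forall>k \<ge> n. K k = K n))"

definition semisimple_artinian :: "('r, 'x) ring_scheme \<Rightarrow> bool" where
  "semisimple_artinian R \<longleftrightarrow>
     semisimple_module R (right_regular R) \<and> artinian_module R (right_regular R)"

definition semilocal :: "('r, 'x) ring_scheme \<Rightarrow> bool" where
  "semilocal R \<longleftrightarrow> semisimple_artinian (R Quot jacobson_radical R)"


section \<open>Tensor products and purity\<close>

text \<open>The tensor product of a right module \<open>A\<close> and a left module \<open>L\<close>, as an abelian group (written
  multiplicatively): the free abelian group on \<open>A \<times> L\<close> modulo the biadditive balanced relations.\<close>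

abbreviation tensor_free ::
    "('r, 'm, 'y) module_scheme \<Rightarrow> ('r, 'l, 'z) module_scheme \<Rightarrow> (('m \<times> 'l) \<Rightarrow>\<^sub>0 int) monoid" where
  "tensor_free A L \<equiv> free_Abelian_group (carrier A \<times> carrier L)"

definition tensor_relators ::
    "('r, 'x) ring_scheme \<Rightarrow> ('r, 'm, 'y) module_scheme \<Rightarrow> ('r, 'l, 'z) module_scheme
      \<Rightarrow> (('m \<times> 'l) \<Rightarrow>\<^sub>0 int) set" where
  "tensor_relators R A L =
     {frag_of (x \<oplus>\<^bsub>A\<^esub> y, l) - frag_of (x, l) - frag_of (y, l) | x y l.
        x \<in> carrier A \<and> y \<in> carrier A \<and> l \<in> carrier L} \<union>
     {frag_of (x, k \<oplus>\<^bsub>L\<^esub> l) - frag_of (x, k) - frag_of (x, l) | x k l.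
        x \<in> carrier A \<and> k \<in> carrier L \<and> l \<in> carrier L} \<union>
     {frag_of (a \<odot>\<^bsub>A\<^esub> x, l) - frag_of (x, a \<odot>\<^bsub>L\<^esub> l) | a x l.
        a \<in> carrier R \<and> x \<in> carrier A \<and> l \<in> carrier L}"

definition tensor_null ::
    "('r, 'x) ring_scheme \<Rightarrow> ('r, 'm, 'y) module_scheme \<Rightarrow> ('r, 'l, 'z) module_scheme
      \<Rightarrow> (('m \<times> 'l) \<Rightarrow>\<^sub>0 int) set" where
  "tensor_null R A L = generate (tensor_free A L) (tensor_relators R A L)"

definition tensor ::
    "('r, 'x) ring_scheme \<Rightarrow> ('r, 'm, 'y) module_scheme \<Rightarrow> ('r, 'l, 'z) module_scheme
      \<Rightarrow> (('m \<times> 'l) \<Rightarrow>\<^sub>0 int) set monoid" where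
  "tensor R A L = tensor_free A L Mod tensor_null R A L"

definition pure_tensor ::
    "('r, 'x) ring_scheme \<Rightarrow> ('r, 'm, 'y) module_scheme \<Rightarrow> ('r, 'l, 'z) module_scheme
      \<Rightarrow> 'm \<Rightarrow> 'l \<Rightarrow> (('m \<times> 'l) \<Rightarrow>\<^sub>0 int) set" where
  "pure_tensor R A L x l = tensor_null R A L #>\<^bsub>tensor_free A L\<^esub> frag_of (x, l)"

text \<open>When \<open>A\<close> is a submodule of \<open>B\<close>, the map from \<open>A \<otimes> L\<close> to \<open>B \<otimes> L\<close> induced by inclusion takes
  the coset of \<open>p\<close> modulo the relations of \<open>A \<otimes> L\<close> to the coset of \<open>p\<close> modulo those of \<open>B \<otimes> L\<close>;
  the latter is the product of the former with the relation subgroup of \<open>B \<otimes> L\<close>.  See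
  \<open>tensor_inclusion_hom\<close> and \<open>tensor_inclusion_pure_tensor\<close> below.\<close>

definition tensor_inclusion ::
    "('r, 'x) ring_scheme \<Rightarrow> ('r, 'm, 'y) module_scheme \<Rightarrow> ('r, 'l, 'z) module_scheme
      \<Rightarrow> (('m \<times> 'l) \<Rightarrow>\<^sub>0 int) set \<Rightarrow> (('m \<times> 'l) \<Rightarrow>\<^sub>0 int) set" where
  "tensor_inclusion R B L X = tensor_null R B L <#>\<^bsub>tensor_free B L\<^esub> X"

text \<open>Purity with the left modules \<open>L\<close> ranging over those whose elements lie in the type \<open>'l\<close>.\<close>

definition pure_submodule_wrt ::
    "'l itself \<Rightarrow> ('r, 'x) ring_scheme \<Rightarrow> ('r, 'm, 'y) module_scheme \<Rightarrow> 'm set \<Rightarrow> bool" where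
  "pure_submodule_wrt _ R M A \<longleftrightarrow>
     submodule A R M \<and>
     (\<forall>L :: ('r, 'l) module. left_module R L \<longrightarrow>
        tensor_inclusion R M L \<in> mon (tensor R (M\<lparr>carrier := A\<rparr>) L) (tensor R M L))"

text \<open>HOL cannot quantify over all types \<open>'l\<close> inside a definition.  The type \<open>'r list\<close> is large enough
  to carry a copy of every finitely generated left \<open>R\<close>-module, which makes the following equivalent
  to purity with respect to left modules over arbitrary types: see \<open>pure_submodule_imp_wrt\<close> below.\<close>

definition pure_submodule ::
    "('r, 'x) ring_scheme \<Rightarrow> ('r, 'm, 'y) module_scheme \<Rightarrow> 'm set \<Rightarrow> bool" where
  "pure_submodule R M A \<longleftrightarrow> pure_submodule_wrt TYPE('r list) R M A"


subsection \<open>The induced map\<close>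

lemma submodule_add: "submodule A R M \<Longrightarrow> x \<in> A \<Longrightarrow> y \<in> A \<Longrightarrow> x \<oplus>\<^bsub>M\<^esub> y \<in> A"
  using subgroup.m_closed[OF submodule.axioms(1), of A R M x y] by simp

lemma submodule_smult: "submodule A R M \<Longrightarrow> a \<in> carrier R \<Longrightarrow> x \<in> A \<Longrightarrow> a \<odot>\<^bsub>M\<^esub> x \<in> A"
  by (rule submodule.smult_closed)

lemma submodule_subset: "submodule A R M \<Longrightarrow> A \<subseteq> carrier M"
  using subgroup.subset[OF submodule.axioms(1), of A R M] by simp

lemma keys_subset_if_carrier:
  "q \<in> X \<Longrightarrow> X \<subseteq> carrier (free_Abelian_group S) \<Longrightarrow> Poly_Mapping.keys q \<subseteq> S"
  by (drule (1) subsetD[rotated]) simp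

lemma tensor_relators_mono:
  assumes "A \<subseteq> carrier M"
  shows "tensor_relators R (M\<lparr>carrier := A\<rparr>) L \<subseteq> tensor_relators R M L"
proof -
  have c: "x \<in> carrier (M\<lparr>carrier := A\<rparr>) \<Longrightarrow> x \<in> carrier M" for x
    using assms by auto
  have o: "add (M\<lparr>carrier := A\<rparr>) = add M" "smult (M\<lparr>carrier := A\<rparr>) = smult M"
    by simp_all
  show ?thesis
    unfolding tensor_relators_def o using c by (intro Un_mono Collect_mono) blast+
qed

lemma tensor_relators_subset:
  assumes "\<And>x y. x \<in> carrier A \<Longrightarrow> y \<in> carrier A \<Longrightarrow> x \<oplus>\<^bsub>A\<^esub> y \<in> carrier A"
    and "\<And>a x. a \<in> carrier R \<Longrightarrow> x \<in> carrier A \<Longrightarrow> a \<odot>\<^bsub>A\<^esub> x \<in> carrier A"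
    and "left_module R L"
  shows "tensor_relators R A L \<subseteq> carrier (tensor_free A L)"
proof -
  interpret L: left_module R L by fact
  have d: "p - q \<in> carrier (tensor_free A L)"
    if "p \<in> carrier (tensor_free A L)" "q \<in> carrier (tensor_free A L)" for p q
    using keys_diff[of p q] that by auto
  have f: "frag_of (x, l) \<in> carrier (tensor_free A L)" if "x \<in> carrier A" "l \<in> carrier L" for x l
    using that by (simp add: keys_frag_of)
  show ?thesis
    unfolding tensor_relators_def
    using assms(1,2) L.smult_closed L.M.a_closed by (intro Un_least subsetI; clarify; intro d f; blast)
qed

lemma tensor_null_subgroup:
  assumes "\<And>x y. x \<in> carrier A \<Longrightarrow> y \<in> carrier A \<Longrightarrow> x \<oplus>\<^bsub>A\<^esub> y \<in> carrier A"
    and "\<And>a x. a \<in> carrier R \<Longrightarrow> x \<in> carrier A \<Longrightarrow> a \<odot>\<^bsub>A\<^esub> x \<in> carrier A"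
    and "left_module R L"
  shows "subgroup (tensor_null R A L) (tensor_free A L)"
  unfolding tensor_null_def
  by (rule group.generate_is_subgroup[OF group_free_Abelian_group tensor_relators_subset[OF assms]])

lemma tensor_null_mono_carrier:
  assumes sub: "submodule A R M" and M: "right_module R M" and L: "left_module R L"
  shows "tensor_null R (M\<lparr>carrier := A\<rparr>) L \<subseteq> tensor_null R M L"
proof
  interpret M: right_module R M by fact
  have AM: "A \<subseteq> carrier M" by (rule submodule_subset[OF sub])
  have relM: "tensor_relators R M L \<subseteq> carrier (tensor_free M L)"
    by (rule tensor_relators_subset) (auto simp: M.smult_closed L)
  have relA: "tensor_relators R (M\<lparr>carrier := A\<rparr>) L \<subseteq> carrier (tensor_free (M\<lparr>carrier := A\<rparr>) L)"
    by (rule tensor_relators_subset) (simp_all add: submodule_add[OF sub] submodule_smult[OF sub] L)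
  have rel: "tensor_relators R (M\<lparr>carrier := A\<rparr>) L \<subseteq> tensor_relators R M L"
    by (rule tensor_relators_mono[OF AM])
  fix p assume "p \<in> tensor_null R (M\<lparr>carrier := A\<rparr>) L"
  then have "p \<in> generate (tensor_free (M\<lparr>carrier := A\<rparr>) L) (tensor_relators R (M\<lparr>carrier := A\<rparr>) L)"
    by (simp add: tensor_null_def)
  then have "p \<in> generate (tensor_free M L) (tensor_relators R M L)"
  proof induction
    case one
    show ?case using generate.one[of "tensor_free M L"] by simp
  next
    case (incl h)
    show ?case by (rule generate.incl, rule subsetD[OF rel incl])
  next
    case (inv h)
    have "h \<in> tensor_relators R M L" by (rule subsetD[OF rel inv])
    then have "inv\<^bsub>tensor_free M L\<^esub> h \<in> generate (tensor_free M L) (tensor_relators R M L)"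
      by (rule generate.inv)
    moreover have "Poly_Mapping.keys h \<subseteq> carrier M \<times> carrier L"
      by (rule keys_subset_if_carrier[OF \<open>h \<in> tensor_relators R M L\<close> relM])
    moreover have "Poly_Mapping.keys h \<subseteq> carrier (M\<lparr>carrier := A\<rparr>) \<times> carrier L"
      by (rule keys_subset_if_carrier[OF inv relA])
    ultimately show ?case by simp
  next
    case (eng h1 h2)
    then show ?case using generate.eng[of h1 "tensor_free M L" _ h2] by simp
  qed
  then show "p \<in> tensor_null R M L" by (simp add: tensor_null_def)
qed

lemma tensor_inclusion_coset:
  assumes sub: "submodule A R M" and M: "right_module R M" and L: "left_module R L"
    and p: "p \<in> carrier (tensor_free (M\<lparr>carrier := A\<rparr>) L)"
  shows "tensor_inclusion R M L (tensor_null R (M\<lparr>carrier := A\<rparr>) L #>\<^bsub>tensor_free (M\<lparr>carrier := A\<rparr>) L\<^esub> p)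
       = tensor_null R M L #>\<^bsub>tensor_free M L\<^esub> p"
proof -
  interpret M: right_module R M by fact
  have KM: "subgroup (tensor_null R M L) (tensor_free M L)"
    by (rule tensor_null_subgroup) (auto simp: M.smult_closed L)
  have KA: "subgroup (tensor_null R (M\<lparr>carrier := A\<rparr>) L) (tensor_free (M\<lparr>carrier := A\<rparr>) L)"
    by (rule tensor_null_subgroup) (simp_all add: submodule_add[OF sub] submodule_smult[OF sub] L)
  have le: "tensor_null R (M\<lparr>carrier := A\<rparr>) L \<subseteq> tensor_null R M L"
    by (rule tensor_null_mono_carrier[OF sub M L])
  have z: "0 \<in> tensor_null R (M\<lparr>carrier := A\<rparr>) L"
    using subgroup.one_closed[OF KA] by simp
  have add: "u + v \<in> tensor_null R M L" if "u \<in> tensor_null R M L" "v \<in> tensor_null R M L" for u v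
    using subgroup.m_closed[OF KM that] by simp
  have "(\<Union>h\<in>tensor_null R M L. \<Union>k\<in>tensor_null R (M\<lparr>carrier := A\<rparr>) L. {h + (k + p)})
      = (\<Union>h\<in>tensor_null R M L. {h + p})" (is "?l = ?r")
  proof
    show "?l \<subseteq> ?r"
      using add le by (force simp: add.assoc[symmetric])
    show "?r \<subseteq> ?l"
      using z by force
  qed
  then show ?thesis
    unfolding tensor_inclusion_def set_mult_def r_coset_def by auto
qed

lemma tensor_inclusion_pure_tensor:
  assumes "submodule A R M" "right_module R M" "left_module R L" "x \<in> A" "l \<in> carrier L"
  shows "tensor_inclusion R M L (pure_tensor R (M\<lparr>carrier := A\<rparr>) L x l) = pure_tensor R M L x l"
  unfolding pure_tensor_def
  by (rule tensor_inclusion_coset) (use assms in auto)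

lemma tensor_inclusion_hom:
  assumes sub: "submodule A R M" and M: "right_module R M" and L: "left_module R L"
  shows "tensor_inclusion R M L \<in> hom (tensor R (M\<lparr>carrier := A\<rparr>) L) (tensor R M L)"
proof -
  interpret M: right_module R M by fact
  let ?A = "M\<lparr>carrier := A\<rparr>"
  have KM: "tensor_null R M L \<lhd> tensor_free M L"
    by (intro comm_group.subgroup_imp_normal abelian_free_Abelian_group tensor_null_subgroup)
      (auto simp: M.smult_closed L)
  have KA: "tensor_null R ?A L \<lhd> tensor_free ?A L"
    by (intro comm_group.subgroup_imp_normal abelian_free_Abelian_group tensor_null_subgroup)
      (simp_all add: submodule_add[OF sub] submodule_smult[OF sub] L)
  have inA: "p \<in> carrier (tensor_free M L)" if "p \<in> carrier (tensor_free ?A L)" for p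
    using that submodule_subset[OF sub] by auto
  show ?thesis
  proof (rule homI)
    fix X assume "X \<in> carrier (tensor R ?A L)"
    then obtain p where p: "p \<in> carrier (tensor_free ?A L)"
      and X: "X = tensor_null R ?A L #>\<^bsub>tensor_free ?A L\<^esub> p"
      by (auto simp: tensor_def carrier_FactGroup simp del: carrier_free_Abelian_group_iff)
    show "tensor_inclusion R M L X \<in> carrier (tensor R M L)"
      unfolding X tensor_inclusion_coset[OF sub M L p]
      using inA[OF p] by (simp add: tensor_def carrier_FactGroup del: carrier_free_Abelian_group_iff)
  next
    fix X Y assume "X \<in> carrier (tensor R ?A L)" "Y \<in> carrier (tensor R ?A L)"
    then obtain p q where p: "p \<in> carrier (tensor_free ?A L)" and q: "q \<in> carrier (tensor_free ?A L)"
      and X: "X = tensor_null R ?A L #>\<^bsub>tensor_free ?A L\<^esub> p"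
      and Y: "Y = tensor_null R ?A L #>\<^bsub>tensor_free ?A L\<^esub> q"
      by (auto simp: tensor_def carrier_FactGroup simp del: carrier_free_Abelian_group_iff)
    have pq: "p + q \<in> carrier (tensor_free ?A L)"
      using monoid.m_closed[OF group.is_monoid[OF group_free_Abelian_group] p q] by simp
    have "X \<otimes>\<^bsub>tensor R ?A L\<^esub> Y = tensor_null R ?A L #>\<^bsub>tensor_free ?A L\<^esub> (p + q)"
      unfolding X Y tensor_def using normal.rcos_sum[OF KA p q] by simp
    moreover have "(tensor_null R M L #>\<^bsub>tensor_free M L\<^esub> p) \<otimes>\<^bsub>tensor R M L\<^esub>
        (tensor_null R M L #>\<^bsub>tensor_free M L\<^esub> q) = tensor_null R M L #>\<^bsub>tensor_free M L\<^esub> (p + q)"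
      unfolding tensor_def using normal.rcos_sum[OF KM inA[OF p] inA[OF q]] by simp
    ultimately show "tensor_inclusion R M L (X \<otimes>\<^bsub>tensor R ?A L\<^esub> Y)
        = tensor_inclusion R M L X \<otimes>\<^bsub>tensor R M L\<^esub> tensor_inclusion R M L Y"
      unfolding X Y tensor_inclusion_coset[OF sub M L p] tensor_inclusion_coset[OF sub M L q]
      using tensor_inclusion_coset[OF sub M L pq] by simp
  qed
qed

lemma tensor_inclusion_mon_iff:
  assumes sub: "submodule A R M" and M: "right_module R M" and L: "left_module R L"
  shows "tensor_inclusion R M L \<in> mon (tensor R (M\<lparr>carrier := A\<rparr>) L) (tensor R M L) \<longleftrightarrow>
    (\<forall>p. Poly_Mapping.keys p \<subseteq> A \<times> carrier L \<longrightarrow> p \<in> tensor_null R M L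
       \<longrightarrow> p \<in> tensor_null R (M\<lparr>carrier := A\<rparr>) L)"
proof -
  interpret M: right_module R M by fact
  let ?A = "M\<lparr>carrier := A\<rparr>"
  let ?FA = "tensor_free ?A L" and ?FM = "tensor_free M L"
  have sM: "subgroup (tensor_null R M L) ?FM"
    by (rule tensor_null_subgroup) (auto simp: M.smult_closed L)
  have sA: "subgroup (tensor_null R ?A L) ?FA"
    by (rule tensor_null_subgroup) (simp_all add: submodule_add[OF sub] submodule_smult[OF sub] L)
  have KM: "tensor_null R M L \<lhd> ?FM" and KA: "tensor_null R ?A L \<lhd> ?FA"
    by (intro comm_group.subgroup_imp_normal abelian_free_Abelian_group sM sA)+
  interpret h: group_hom "tensor R ?A L" "tensor R M L" "tensor_inclusion R M L"
    unfolding group_hom_def group_hom_axioms_def tensor_def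
    using normal.factorgroup_is_group[OF KA] normal.factorgroup_is_group[OF KM]
      tensor_inclusion_hom[OF sub M L] by (simp add: tensor_def)
  have inA: "p \<in> carrier ?FM" if "p \<in> carrier ?FA" for p
    using that submodule_subset[OF sub] by auto
  have cM: "tensor_null R M L #>\<^bsub>?FM\<^esub> p = tensor_null R M L \<longleftrightarrow> p \<in> tensor_null R M L"
    if "p \<in> carrier ?FM" for p
    using that by (metis group_free_Abelian_group group.coset_join1 group.coset_join2 sM subgroup.subset)
  have cA: "tensor_null R ?A L #>\<^bsub>?FA\<^esub> p = tensor_null R ?A L \<longleftrightarrow> p \<in> tensor_null R ?A L"
    if "p \<in> carrier ?FA" for p
    using that by (metis group_free_Abelian_group group.coset_join1 group.coset_join2 sA subgroup.subset)
  have car: "carrier (tensor R ?A L) = (\<lambda>p. tensor_null R ?A L #>\<^bsub>?FA\<^esub> p) ` carrier ?FA"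
    by (simp add: tensor_def carrier_FactGroup)
  have ones: "\<one>\<^bsub>tensor R ?A L\<^esub> = tensor_null R ?A L" "\<one>\<^bsub>tensor R M L\<^esub> = tensor_null R M L"
    by (simp_all add: tensor_def)
  have "tensor_inclusion R M L \<in> mon (tensor R ?A L) (tensor R M L) \<longleftrightarrow>
      (\<forall>X \<in> carrier (tensor R ?A L). tensor_inclusion R M L X = \<one>\<^bsub>tensor R M L\<^esub>
        \<longrightarrow> X = \<one>\<^bsub>tensor R ?A L\<^esub>)"
    using tensor_inclusion_hom[OF sub M L] h.inj_on_one_iff by (auto simp: mon_def)
  also have "\<dots> \<longleftrightarrow> (\<forall>p \<in> carrier ?FA. p \<in> tensor_null R M L \<longrightarrow> p \<in> tensor_null R ?A L)"
    unfolding car ones ball_simps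
    using tensor_inclusion_coset[OF sub M L] cA cM[OF inA] by metis
  finally show ?thesis by (simp add: Ball_def)
qed


subsection \<open>Independence of purity from the type carrying the left modules\<close>

lemma tensor_relatorsI:
  "\<lbrakk>x \<in> carrier A; y \<in> carrier A; l \<in> carrier L\<rbrakk> \<Longrightarrow>
    frag_of (x \<oplus>\<^bsub>A\<^esub> y, l) - frag_of (x, l) - frag_of (y, l) \<in> tensor_relators R A L"
  "\<lbrakk>x \<in> carrier A; k \<in> carrier L; l \<in> carrier L\<rbrakk> \<Longrightarrow>
    frag_of (x, k \<oplus>\<^bsub>L\<^esub> l) - frag_of (x, k) - frag_of (x, l) \<in> tensor_relators R A L"
  "\<lbrakk>a \<in> carrier R; x \<in> carrier A; l \<in> carrier L\<rbrakk> \<Longrightarrow>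
    frag_of (a \<odot>\<^bsub>A\<^esub> x, l) - frag_of (x, a \<odot>\<^bsub>L\<^esub> l) \<in> tensor_relators R A L"
  unfolding tensor_relators_def by blast+

lemma tensor_relatorsE:
  assumes "q \<in> tensor_relators R A L"
  obtains (1) x y l where "q = frag_of (x \<oplus>\<^bsub>A\<^esub> y, l) - frag_of (x, l) - frag_of (y, l)"
        "x \<in> carrier A" "y \<in> carrier A" "l \<in> carrier L"
      | (2) x k l where "q = frag_of (x, k \<oplus>\<^bsub>L\<^esub> l) - frag_of (x, k) - frag_of (x, l)"
        "x \<in> carrier A" "k \<in> carrier L" "l \<in> carrier L"
      | (3) a x l where "q = frag_of (a \<odot>\<^bsub>A\<^esub> x, l) - frag_of (x, a \<odot>\<^bsub>L\<^esub> l)"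
        "a \<in> carrier R" "x \<in> carrier A" "l \<in> carrier L"
  using assms unfolding tensor_relators_def
  apply (elim UnE CollectE exE conjE)
    apply (rule that(1); assumption)
   apply (rule that(2); assumption)
  apply (rule that(3); assumption)
  done

lemma tensor_null_image:
  assumes A_add: "\<And>x y. x \<in> carrier A \<Longrightarrow> y \<in> carrier A \<Longrightarrow> x \<oplus>\<^bsub>A\<^esub> y \<in> carrier A"
    and A_smult: "\<And>a x. a \<in> carrier R \<Longrightarrow> x \<in> carrier A \<Longrightarrow> a \<odot>\<^bsub>A\<^esub> x \<in> carrier A"
    and L: "left_module R L" and L': "left_module R L'"
    and h: "h \<in> mod_hom R L L'"
    and p: "p \<in> tensor_null R A L"
  shows "frag_extend (\<lambda>(x, l). frag_of (x, h l)) p \<in> tensor_null R A L'"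
proof -
  let ?e = "frag_extend (\<lambda>(x, l). frag_of (x, h l))"
  interpret L: left_module R L by fact
  have hc: "l \<in> carrier L \<Longrightarrow> h l \<in> carrier L'" for l
    using h by (auto simp: mod_hom_def)
  have ha: "k \<in> carrier L \<Longrightarrow> l \<in> carrier L \<Longrightarrow> h (k \<oplus>\<^bsub>L\<^esub> l) = h k \<oplus>\<^bsub>L'\<^esub> h l" for k l
    using h by (auto simp: mod_hom_def)
  have hs: "a \<in> carrier R \<Longrightarrow> l \<in> carrier L \<Longrightarrow> h (a \<odot>\<^bsub>L\<^esub> l) = a \<odot>\<^bsub>L'\<^esub> h l" for a l
    using h by (auto simp: mod_hom_def)
  have rel: "?e q \<in> tensor_relators R A L'" if "q \<in> tensor_relators R A L" for q
  proof -
    from that show ?thesis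
    proof (cases rule: tensor_relatorsE)
      case (1 x y l)
      then have "?e q = frag_of (x \<oplus>\<^bsub>A\<^esub> y, h l) - frag_of (x, h l) - frag_of (y, h l)"
        by (simp add: frag_extend_diff)
      then show ?thesis using 1 hc by (simp add: tensor_relatorsI(1))
    next
      case (2 x k l)
      then have "?e q = frag_of (x, h k \<oplus>\<^bsub>L'\<^esub> h l) - frag_of (x, h k) - frag_of (x, h l)"
        by (simp add: frag_extend_diff ha)
      then show ?thesis using 2 hc by (simp add: tensor_relatorsI(2))
    next
      case (3 a x l)
      then have "?e q = frag_of (a \<odot>\<^bsub>A\<^esub> x, h l) - frag_of (x, a \<odot>\<^bsub>L'\<^esub> h l)"
        by (simp add: frag_extend_diff hs)
      then show ?thesis using 3 hc by (simp add: tensor_relatorsI(3))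
    qed
  qed
  have sub: "tensor_relators R A L \<subseteq> carrier (tensor_free A L)"
    by (rule tensor_relators_subset[OF A_add A_smult L])
  have sub': "tensor_relators R A L' \<subseteq> carrier (tensor_free A L')"
    by (rule tensor_relators_subset[OF A_add A_smult L'])
  from p have "p \<in> generate (tensor_free A L) (tensor_relators R A L)"
    by (simp add: tensor_null_def)
  then have "?e p \<in> generate (tensor_free A L') (tensor_relators R A L')"
  proof induction
    case one
    show ?case using generate.one[of "tensor_free A L'"] by simp
  next
    case (incl q)
    show ?case by (rule generate.incl, rule rel[OF incl])
  next
    case (inv q)
    have "inv\<^bsub>tensor_free A L'\<^esub> (?e q) \<in> generate (tensor_free A L') (tensor_relators R A L')"
      by (intro generate.inv rel inv)
    moreover have "Poly_Mapping.keys q \<subseteq> carrier A \<times> carrier L"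
      by (rule keys_subset_if_carrier[OF inv sub])
    moreover have "Poly_Mapping.keys (?e q) \<subseteq> carrier A \<times> carrier L'"
      by (rule keys_subset_if_carrier[OF rel[OF inv] sub'])
    ultimately show ?case by (simp add: frag_extend_minus)
  next
    case (eng q1 q2)
    then show ?case
      using generate.eng[of "?e q1" "tensor_free A L'" _ "?e q2"] by (simp add: frag_extend_add)
  qed
  then show ?thesis by (simp add: tensor_null_def)
qed

lemma left_module_submodule:
  assumes "left_module R L" "submodule S R L"
  shows "left_module R (L\<lparr>carrier := S\<rparr>)"
proof -
  interpret L: left_module R L by fact
  have SL: "x \<in> carrier L" if "x \<in> S" for x
    using submodule_subset[OF assms(2)] that by blast
  have zero: "\<zero>\<^bsub>L\<^esub> \<in> S"
    using subgroup.one_closed[OF submodule.axioms(1)[OF assms(2)]] by simp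
  have neg: "\<ominus>\<^bsub>L\<^esub> x \<in> S" if "x \<in> S" for x
    using subgroup.m_inv_closed[OF submodule.axioms(1)[OF assms(2)] that] by (simp add: a_inv_def)
  have "abelian_group (L\<lparr>carrier := S\<rparr>)"
  proof (rule abelian_groupI)
    fix x assume "x \<in> carrier (L\<lparr>carrier := S\<rparr>)"
    then show "\<exists>y \<in> carrier (L\<lparr>carrier := S\<rparr>). y \<oplus>\<^bsub>L\<lparr>carrier := S\<rparr>\<^esub> x = \<zero>\<^bsub>L\<lparr>carrier := S\<rparr>\<^esub>"
      using neg SL by (intro bexI[of _ "\<ominus>\<^bsub>L\<^esub> x"]) (simp_all add: L.M.l_neg)
  qed (simp_all add: submodule_add[OF assms(2)] zero SL L.M.a_ac)
  then show ?thesis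
    unfolding left_module_def left_module_axioms_def
    using L.R.ring_axioms
    by (simp add: SL submodule_smult[OF assms(2)] L.smult_l_distr L.smult_r_distr L.smult_assoc
        L.smult_one)
qed

lemma tensor_null_local:
  fixes R :: "('r, 'x) ring_scheme" and M :: "('r, 'm, 'y) module_scheme"
    and L :: "('r, 'l, 'z) module_scheme"
  assumes M: "right_module R M" and L: "left_module R L" and p: "p \<in> tensor_null R M L"
  shows "\<exists>T. finite T \<and> T \<subseteq> carrier L \<and>
    (\<forall>S. submodule S R L \<longrightarrow> T \<subseteq> S \<longrightarrow> p \<in> tensor_null R M (L\<lparr>carrier := S\<rparr>))"
proof -
  interpret M: right_module R M by fact
  interpret L: left_module R L by fact
  have relsub: "tensor_relators R M L' \<subseteq> carrier (tensor_free M L')"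
    if "left_module R L'" for L' :: "('r, 'l, 'z) module_scheme"
    by (rule tensor_relators_subset) (auto simp: M.smult_closed that)
  have rel: "\<exists>T. finite T \<and> T \<subseteq> carrier L \<and>
    (\<forall>S. submodule S R L \<longrightarrow> T \<subseteq> S \<longrightarrow> q \<in> tensor_relators R M (L\<lparr>carrier := S\<rparr>))"
    if "q \<in> tensor_relators R M L" for q
  proof -
    from that show ?thesis
    proof (cases rule: tensor_relatorsE)
      case (1 x y l)
      have "q \<in> tensor_relators R M (L\<lparr>carrier := S\<rparr>)" if "{l} \<subseteq> S" for S
        using tensor_relatorsI(1)[of x M y l "L\<lparr>carrier := S\<rparr>" R] 1 that by simp
      then show ?thesis
        using 1(4) by (intro exI[of _ "{l}"]) simp
    next
      case (2 x k l)
      have "q \<in> tensor_relators R M (L\<lparr>carrier := S\<rparr>)" if "{k, l} \<subseteq> S" for S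
        using tensor_relatorsI(2)[of x M k "L\<lparr>carrier := S\<rparr>" l R] 2 that by simp
      then show ?thesis
        using 2(3,4) by (intro exI[of _ "{k, l}"]) simp
    next
      case (3 a x l)
      have "q \<in> tensor_relators R M (L\<lparr>carrier := S\<rparr>)" if "{l} \<subseteq> S" for S
        using tensor_relatorsI(3)[of a R x M l "L\<lparr>carrier := S\<rparr>"] 3 that by simp
      then show ?thesis
        using 3(4) by (intro exI[of _ "{l}"]) simp
    qed
  qed
  from p have "p \<in> generate (tensor_free M L) (tensor_relators R M L)"
    by (simp add: tensor_null_def)
  then show ?thesis
  proof induction
    case one
    have "\<one>\<^bsub>tensor_free M L\<^esub> \<in> tensor_null R M (L\<lparr>carrier := S\<rparr>)" for S
      using generate.one[of "tensor_free M (L\<lparr>carrier := S\<rparr>)"] by (simp add: tensor_null_def)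
    then show ?case by blast
  next
    case (incl q)
    then show ?case using rel[OF incl] by (metis generate.incl tensor_null_def)
  next
    case (inv q)
    then have q: "Poly_Mapping.keys q \<subseteq> carrier M \<times> carrier L"
      using keys_subset_if_carrier[OF _ relsub[OF L]] by blast
    have "inv\<^bsub>tensor_free M L\<^esub> q \<in> tensor_null R M (L\<lparr>carrier := S\<rparr>)"
      if S: "submodule S R L" and qS: "q \<in> tensor_relators R M (L\<lparr>carrier := S\<rparr>)" for S
    proof -
      have "Poly_Mapping.keys q \<subseteq> carrier M \<times> carrier (L\<lparr>carrier := S\<rparr>)"
        by (rule keys_subset_if_carrier[OF qS relsub[OF left_module_submodule[OF L S]]])
      then show ?thesis
        using generate.inv[OF qS, of "tensor_free M (L\<lparr>carrier := S\<rparr>)"] q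
        by (simp add: tensor_null_def)
    qed
    then show ?case using rel[OF inv] by metis
  next
    case (eng q1 q2)
    then obtain T1 T2 where
      T1: "finite T1" "T1 \<subseteq> carrier L"
        "\<And>S. submodule S R L \<Longrightarrow> T1 \<subseteq> S \<Longrightarrow> q1 \<in> tensor_null R M (L\<lparr>carrier := S\<rparr>)" and
      T2: "finite T2" "T2 \<subseteq> carrier L"
        "\<And>S. submodule S R L \<Longrightarrow> T2 \<subseteq> S \<Longrightarrow> q2 \<in> tensor_null R M (L\<lparr>carrier := S\<rparr>)"
      by blast
    have "q1 \<otimes>\<^bsub>tensor_free M L\<^esub> q2 \<in> tensor_null R M (L\<lparr>carrier := S\<rparr>)"
      if "submodule S R L" "T1 \<union> T2 \<subseteq> S" for S
      using generate.eng[of q1 "tensor_free M (L\<lparr>carrier := S\<rparr>)" _ q2] T1(3)[of S] T2(3)[of S] that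
      by (simp add: tensor_null_def)
    then show ?case
      using T1(1,2) T2(1,2) by (intro exI[of _ "T1 \<union> T2"]) auto
  qed
qed

fun lincomb_list :: "('r, 'l, 'z) module_scheme \<Rightarrow> 'r list \<Rightarrow> 'l list \<Rightarrow> 'l" where
  "lincomb_list L (a # as) (t # ts) = a \<odot>\<^bsub>L\<^esub> t \<oplus>\<^bsub>L\<^esub> lincomb_list L as ts"
| "lincomb_list L _ _ = \<zero>\<^bsub>L\<^esub>"

lemma finite_subset_small_submodule:
  fixes R :: "('r, 'x) ring_scheme" and L :: "('r, 'l, 'z) module_scheme"
  assumes L: "left_module R L" and T: "finite T" "T \<subseteq> carrier L"
  shows "\<exists>S (f :: 'r list \<Rightarrow> 'l). submodule S R L \<and> T \<subseteq> S \<and> S \<subseteq> range f"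
proof -
  interpret L: left_module R L by fact
  have zero_smult: "\<zero>\<^bsub>R\<^esub> \<odot>\<^bsub>L\<^esub> x = \<zero>\<^bsub>L\<^esub>" if x: "x \<in> carrier L" for x
  proof -
    have "\<zero>\<^bsub>R\<^esub> \<odot>\<^bsub>L\<^esub> x \<oplus>\<^bsub>L\<^esub> \<zero>\<^bsub>R\<^esub> \<odot>\<^bsub>L\<^esub> x = \<zero>\<^bsub>R\<^esub> \<odot>\<^bsub>L\<^esub> x"
      using L.smult_l_distr[of "\<zero>\<^bsub>R\<^esub>" "\<zero>\<^bsub>R\<^esub>" x] x by simp
    then show ?thesis
      using L.smult_closed[of "\<zero>\<^bsub>R\<^esub>" x] x by (metis L.M.add.r_cancel_one' L.R.zero_closed)
  qed
  have smult_zero: "a \<odot>\<^bsub>L\<^esub> \<zero>\<^bsub>L\<^esub> = \<zero>\<^bsub>L\<^esub>" if a: "a \<in> carrier R" for a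
  proof -
    have "a \<odot>\<^bsub>L\<^esub> \<zero>\<^bsub>L\<^esub> \<oplus>\<^bsub>L\<^esub> a \<odot>\<^bsub>L\<^esub> \<zero>\<^bsub>L\<^esub> = a \<odot>\<^bsub>L\<^esub> \<zero>\<^bsub>L\<^esub>"
      using L.smult_r_distr[of a "\<zero>\<^bsub>L\<^esub>" "\<zero>\<^bsub>L\<^esub>"] a by simp
    then show ?thesis
      using L.smult_closed[of a "\<zero>\<^bsub>L\<^esub>"] a by (metis L.M.add.r_cancel_one' L.M.zero_closed)
  qed
  have neg_smult: "(\<ominus>\<^bsub>R\<^esub> \<one>\<^bsub>R\<^esub>) \<odot>\<^bsub>L\<^esub> x = \<ominus>\<^bsub>L\<^esub> x" if x: "x \<in> carrier L" for x
  proof -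
    have "(\<ominus>\<^bsub>R\<^esub> \<one>\<^bsub>R\<^esub>) \<odot>\<^bsub>L\<^esub> x \<oplus>\<^bsub>L\<^esub> x = \<zero>\<^bsub>L\<^esub>"
      using L.smult_l_distr[of "\<ominus>\<^bsub>R\<^esub> \<one>\<^bsub>R\<^esub>" "\<one>\<^bsub>R\<^esub>" x] x L.smult_one[OF x] zero_smult[OF x]
      by (simp add: L.R.l_neg)
    then show ?thesis
      using x L.smult_closed[of "\<ominus>\<^bsub>R\<^esub> \<one>\<^bsub>R\<^esub>" x] by (metis L.M.minus_equality L.R.a_inv_closed L.R.one_closed)
  qed
  obtain ts where ts: "set ts = T" using T(1) finite_list by blast
  define V where "V us = {lincomb_list L as us | as. length as = length us \<and> set as \<subseteq> carrier R}" for us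
  have V_Nil: "V [] = {\<zero>\<^bsub>L\<^esub>}" by (auto simp: V_def)
  have V_Cons: "V (u # us) = {a \<odot>\<^bsub>L\<^esub> u \<oplus>\<^bsub>L\<^esub> v | a v. a \<in> carrier R \<and> v \<in> V us}" for u us
  proof
    show "V (u # us) \<subseteq> {a \<odot>\<^bsub>L\<^esub> u \<oplus>\<^bsub>L\<^esub> v | a v. a \<in> carrier R \<and> v \<in> V us}"
      by (auto simp: V_def length_Suc_conv) blast
    show "{a \<odot>\<^bsub>L\<^esub> u \<oplus>\<^bsub>L\<^esub> v | a v. a \<in> carrier R \<and> v \<in> V us} \<subseteq> V (u # us)"
    proof
      fix w assume "w \<in> {a \<odot>\<^bsub>L\<^esub> u \<oplus>\<^bsub>L\<^esub> v | a v. a \<in> carrier R \<and> v \<in> V us}"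
      then obtain a as where "w = lincomb_list L (a # as) (u # us)" "length as = length us"
        "set (a # as) \<subseteq> carrier R" by (auto simp: V_def)
      then show "w \<in> V (u # us)" unfolding V_def by (intro CollectI exI[of _ "a # as"]) simp
    qed
  qed
  have V: "V us \<subseteq> carrier L \<and> \<zero>\<^bsub>L\<^esub> \<in> V us \<and> set us \<subseteq> V us \<and>
      (\<forall>v \<in> V us. \<forall>w \<in> V us. v \<oplus>\<^bsub>L\<^esub> w \<in> V us) \<and> (\<forall>a \<in> carrier R. \<forall>v \<in> V us. a \<odot>\<^bsub>L\<^esub> v \<in> V us)"
    if "set us \<subseteq> carrier L" for us
    using that
  proof (induction us)
    case Nil
    show ?case by (simp add: V_Nil smult_zero)
  next
    case (Cons u us)
    then have IH: "V us \<subseteq> carrier L" "\<zero>\<^bsub>L\<^esub> \<in> V us" "set us \<subseteq> V us"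
      "\<And>v w. v \<in> V us \<Longrightarrow> w \<in> V us \<Longrightarrow> v \<oplus>\<^bsub>L\<^esub> w \<in> V us"
      "\<And>a v. a \<in> carrier R \<Longrightarrow> v \<in> V us \<Longrightarrow> a \<odot>\<^bsub>L\<^esub> v \<in> V us"
      and u: "u \<in> carrier L" by auto
    have I: "a \<odot>\<^bsub>L\<^esub> u \<oplus>\<^bsub>L\<^esub> v \<in> V (u # us)" if "a \<in> carrier R" "v \<in> V us" for a v
      using that V_Cons by blast
    have sub: "V (u # us) \<subseteq> carrier L"
      using IH(1) u L.smult_closed by (auto simp: V_Cons)
    have old: "v \<in> V (u # us)" if "v \<in> V us" for v
      using I[of "\<zero>\<^bsub>R\<^esub>" v] that IH(1) u zero_smult by (auto simp: subset_iff)
    have new: "u \<in> V (u # us)"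
      using I[of "\<one>\<^bsub>R\<^esub>" "\<zero>\<^bsub>L\<^esub>"] IH(2) u L.smult_one by simp
    have add: "v \<oplus>\<^bsub>L\<^esub> w \<in> V (u # us)" if vw: "v \<in> V (u # us)" "w \<in> V (u # us)" for v w
    proof -
      obtain a v' b w' where *: "v = a \<odot>\<^bsub>L\<^esub> u \<oplus>\<^bsub>L\<^esub> v'" "w = b \<odot>\<^bsub>L\<^esub> u \<oplus>\<^bsub>L\<^esub> w'"
        "a \<in> carrier R" "b \<in> carrier R" "v' \<in> V us" "w' \<in> V us"
        using vw by (auto simp: V_Cons)
      have "v' \<in> carrier L" "w' \<in> carrier L" using * IH(1) by auto
      then have "v \<oplus>\<^bsub>L\<^esub> w = (a \<oplus>\<^bsub>R\<^esub> b) \<odot>\<^bsub>L\<^esub> u \<oplus>\<^bsub>L\<^esub> (v' \<oplus>\<^bsub>L\<^esub> w')"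
        using * u L.smult_closed by (simp add: L.smult_l_distr L.M.a_ac)
      then show ?thesis using I[of "a \<oplus>\<^bsub>R\<^esub> b" "v' \<oplus>\<^bsub>L\<^esub> w'"] * IH(4) by simp
    qed
    have smult: "c \<odot>\<^bsub>L\<^esub> v \<in> V (u # us)" if c: "c \<in> carrier R" and v: "v \<in> V (u # us)" for c v
    proof -
      obtain a v' where *: "v = a \<odot>\<^bsub>L\<^esub> u \<oplus>\<^bsub>L\<^esub> v'" "a \<in> carrier R" "v' \<in> V us"
        using v by (auto simp: V_Cons)
      have "v' \<in> carrier L" using * IH(1) by auto
      then have "c \<odot>\<^bsub>L\<^esub> v = (c \<otimes>\<^bsub>R\<^esub> a) \<odot>\<^bsub>L\<^esub> u \<oplus>\<^bsub>L\<^esub> c \<odot>\<^bsub>L\<^esub> v'"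
        using * u c L.smult_closed by (simp add: L.smult_r_distr L.smult_assoc)
      then show ?thesis using I[of "c \<otimes>\<^bsub>R\<^esub> a" "c \<odot>\<^bsub>L\<^esub> v'"] * c IH(5) by simp
    qed
    show ?case using sub old new add smult IH(2,3) by auto
  qed
  have Vts: "V ts \<subseteq> carrier L" "\<zero>\<^bsub>L\<^esub> \<in> V ts" "T \<subseteq> V ts"
      "\<And>v w. v \<in> V ts \<Longrightarrow> w \<in> V ts \<Longrightarrow> v \<oplus>\<^bsub>L\<^esub> w \<in> V ts"
      "\<And>a v. a \<in> carrier R \<Longrightarrow> v \<in> V ts \<Longrightarrow> a \<odot>\<^bsub>L\<^esub> v \<in> V ts"
    using V[of ts] T(2) ts by auto
  have neg: "\<ominus>\<^bsub>L\<^esub> v \<in> V ts" if "v \<in> V ts" for v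
    using Vts(5)[of "\<ominus>\<^bsub>R\<^esub> \<one>\<^bsub>R\<^esub>" v] neg_smult[of v] that Vts(1) by auto
  have "submodule (V ts) R L"
    by (intro submodule.intro subgroup.intro submodule_axioms.intro)
      (use Vts neg in \<open>auto simp: a_inv_def\<close>)
  moreover have "V ts \<subseteq> range (\<lambda>as. lincomb_list L as ts)"
    by (auto simp: V_def)
  ultimately show ?thesis using Vts(3) by blast
qed

lemma left_module_transfer:
  fixes R :: "('r, 'x) ring_scheme" and L :: "('r, 'l, 'z) module_scheme" and g :: "'l \<Rightarrow> 'k"
  assumes L: "left_module R L" and g: "inj_on g (carrier L)"
  obtains K :: "('r, 'k) module" where "left_module R K" "g \<in> mod_hom R L K"
    "inv_into (carrier L) g \<in> mod_hom R K L"
proof -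
  interpret L: left_module R L by fact
  define f where "f = inv_into (carrier L) g"
  define K :: "('r, 'k) module" where
    "K = \<lparr>carrier = g ` carrier L, mult = undefined, one = undefined, ring.zero = g \<zero>\<^bsub>L\<^esub>,
      ring.add = (\<lambda>u v. g (f u \<oplus>\<^bsub>L\<^esub> f v)), smult = (\<lambda>a u. g (a \<odot>\<^bsub>L\<^esub> f u))\<rparr>"
  have fg: "f (g l) = l" if "l \<in> carrier L" for l
    using that g by (simp add: f_def)
  have ab: "abelian_group K"
  proof (rule abelian_groupI)
    fix x assume "x \<in> carrier K"
    then obtain l where l: "l \<in> carrier L" "x = g l" by (auto simp: K_def)
    show "\<exists>y \<in> carrier K. y \<oplus>\<^bsub>K\<^esub> x = \<zero>\<^bsub>K\<^esub>"
      using l by (intro bexI[of _ "g (\<ominus>\<^bsub>L\<^esub> l)"]) (auto simp: K_def fg L.M.l_neg)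
  qed (auto simp: K_def fg L.M.a_ac)
  have "left_module R K"
    unfolding left_module_def left_module_axioms_def
    using ab L.R.ring_axioms
    by (auto simp: K_def fg L.smult_closed L.smult_l_distr L.smult_r_distr L.smult_assoc L.smult_one)
  moreover have "g \<in> mod_hom R L K"
    by (auto simp: mod_hom_def K_def fg)
  moreover have "f \<in> mod_hom R K L"
    by (auto simp: mod_hom_def K_def fg L.smult_closed)
  ultimately show ?thesis using that by (simp add: f_def)
qed

theorem pure_submodule_imp_wrt:
  fixes R :: "('r, 'x) ring_scheme" and M :: "('r, 'm, 'y) module_scheme"
  assumes M: "right_module R M" and pure: "pure_submodule R M A"
  shows "pure_submodule_wrt TYPE('l) R M A"
proof -
  have sub: "submodule A R M"
    using pure by (simp add: pure_submodule_def pure_submodule_wrt_def)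
  interpret M: right_module R M by fact
  let ?A = "M\<lparr>carrier := A\<rparr>"
  have "p \<in> tensor_null R ?A L"
    if L: "left_module R L" and keys: "Poly_Mapping.keys p \<subseteq> A \<times> carrier L"
      and p: "p \<in> tensor_null R M L" for L :: "('r, 'l) module" and p
  proof -
    obtain T where T: "finite T" "T \<subseteq> carrier L"
      "\<And>S. submodule S R L \<Longrightarrow> T \<subseteq> S \<Longrightarrow> p \<in> tensor_null R M (L\<lparr>carrier := S\<rparr>)"
      using tensor_null_local[OF M L p] by blast
    have fin: "finite (T \<union> snd ` Poly_Mapping.keys p)"
      using T(1) by simp
    have sub_car: "T \<union> snd ` Poly_Mapping.keys p \<subseteq> carrier L"
      using T(2) keys by auto
    then obtain S and f :: "'r list \<Rightarrow> 'l" where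
      S: "submodule S R L" "T \<union> snd ` Poly_Mapping.keys p \<subseteq> S" "S \<subseteq> range f"
      using finite_subset_small_submodule[OF L fin sub_car] by blast
    have keyS: "x \<in> A" "l \<in> S" if "(x, l) \<in> Poly_Mapping.keys p" for x l
      using keys S(2) that by force+
    define g where "g = inv_into UNIV f"
    let ?S = "L\<lparr>carrier := S\<rparr>"
    have LS: "left_module R ?S" by (rule left_module_submodule[OF L S(1)])
    have "inj_on g (carrier ?S)"
      using S(3) unfolding g_def by (simp add: inj_on_inv_into)
    then obtain K :: "('r, 'r list) module" where K: "left_module R K" "g \<in> mod_hom R ?S K"
        "inv_into (carrier ?S) g \<in> mod_hom R K ?S"
      using left_module_transfer[OF LS] by blast
    define h where "h = inv_into (carrier ?S) g"
    have hg: "h (g l) = l" if "l \<in> S" for l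
      using that \<open>inj_on g (carrier ?S)\<close> by (simp add: h_def)
    have "h \<in> mod_hom R K ?S" using K(3) by (simp add: h_def)
    then have h: "h \<in> mod_hom R K L"
      using submodule_subset[OF S(1)] by (simp add: mod_hom_def Pi_iff subset_iff)
    define q where "q = frag_extend (\<lambda>(x, l). frag_of (x, g l)) p"
    have pS: "p \<in> tensor_null R M ?S" using T(3) S by simp
    have q: "q \<in> tensor_null R M K"
      unfolding q_def
      by (rule tensor_null_image[OF _ _ LS K(1,2) pS]) (auto simp: M.smult_closed)
    have "Poly_Mapping.keys q \<subseteq> A \<times> carrier K"
    proof -
      have "Poly_Mapping.keys q \<subseteq> (\<lambda>(x, l). (x, g l)) ` Poly_Mapping.keys p"
      proof
        fix z assume "z \<in> Poly_Mapping.keys q"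
        then obtain y where "y \<in> Poly_Mapping.keys p"
            "z \<in> Poly_Mapping.keys (case y of (x, l) \<Rightarrow> frag_of (x, g l))"
          unfolding q_def using keys_frag_extend by fast
        then show "z \<in> (\<lambda>(x, l). (x, g l)) ` Poly_Mapping.keys p"
          by (cases y) (force simp: keys_frag_of)
      qed
      moreover have "g l \<in> carrier K" if "l \<in> S" for l
        using K(2) that by (auto simp: mod_hom_def)
      ultimately show ?thesis by (auto dest!: subsetD intro: keyS)
    qed
    moreover have "tensor_inclusion R M K \<in> mon (tensor R ?A K) (tensor R M K)"
      using pure K(1) unfolding pure_submodule_def pure_submodule_wrt_def by blast
    ultimately have qA: "q \<in> tensor_null R ?A K"
      unfolding tensor_inclusion_mon_iff[OF sub M K(1)] using q by blast
    have "frag_extend (\<lambda>(x, l). frag_of (x, h l)) q \<in> tensor_null R ?A L"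
      by (rule tensor_null_image[OF _ _ K(1) L h qA]) (simp_all add: submodule_add[OF sub] submodule_smult[OF sub])
    moreover have "frag_extend (\<lambda>(x, l). frag_of (x, h l)) q = p"
    proof -
      have "frag_extend (\<lambda>(x, l). frag_of (x, h l)) q = frag_extend (\<lambda>(x, l). frag_of (x, h (g l))) p"
        unfolding q_def
        using frag_extend_compose[of "\<lambda>(x, l). frag_of (x, h l)" "\<lambda>(x, l). (x, g l)" p]
        by (simp add: o_def case_prod_unfold)
      also have "\<dots> = frag_extend frag_of p"
        by (rule frag_extend_eq) (auto simp: hg keyS)
      finally show ?thesis using frag_expansion[of p] by simp
    qed
    ultimately show ?thesis by simp
  qed
  then show ?thesis
    unfolding pure_submodule_wrt_def
    by (simp add: sub tensor_inclusion_mon_iff[OF sub M])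
qed

end

theory Submission
  imports Defs
begin

text \<open>
  Write \<open>J\<close> for the Jacobson radical.  Simple modules are killed by \<open>J\<close>, hence so is \<open>S'\<close>, and
  \<open>M / MJ\<close> is semisimple because \<open>R\<close> is semilocal.  So \<open>S'\<close> has a complement as soon as
  \<open>S' \<inter> MJ = 0\<close>.  Purity gives this by tensoring with \<open>R / J\<close>; simple-direct-injectivity gives
  it since a nonzero element of \<open>S' \<inter> MJ\<close> would yield a simple direct summand inside \<open>MJ\<close>,
  which is impossible.  Conversely, if \<open>S'\<close> is a fully invariant summand and \<open>A\<close> is isomorphic to a
  simple summand \<open>B\<close>, then the isomorphism extends to an endomorphism of \<open>M\<close>, so \<open>A \<subseteq> S'\<close>, and \<open>A\<close>
  is a summand of the semisimple module \<open>S'\<close>.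
\<close>

section \<open>Submodules\<close>

text \<open>The quotient \<open>M/MJ\<close> is never formed. Its semisimplicity is replaced by a
  statement about submodules of \<open>M\<close>: every proper \<open>D\<close> above
  \<open>MJ\<close> has an \<open>X\<close> that is not inside \<open>D\<close> but meets
  \<open>D\<close> within \<open>MJ\<close>. Zorn's lemma turns this into a complement, and the same
  criterion, based at a complement of \<open>S'\<close> instead of \<open>MJ\<close>, splits off the
  submodules of \<open>S'\<close>. The equation \<open>S' \<inter> MJ = 0\<close> cannot be read off
  from the summands one by one: each simple summand misses \<open>MJ\<close>, but a sum of
  submodules missing \<open>MJ\<close> may still meet it. Simple-direct-injectivity is therefore
  applied while enlarging a submodule by one simple summand at a time. \<open>J\<close> is an
  intersection of maximal right ideals, so its being a left ideal has to be proved; the ring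
  \<open>R/J\<close> depends on this, and so does the fact that the elements killed by
  \<open>J\<close> form a submodule. Purity is stated for left modules on lists over the ring,
  whereas \<open>R/J\<close> consists of cosets, so the test on \<open>R/J\<close> goes through
  \<open>pure_submodule_imp_wrt\<close>.\<close>

context right_module
begin

lemma smult_l_null [simp]: "x \<in> carrier M \<Longrightarrow> \<zero> \<odot>\<^bsub>M\<^esub> x = \<zero>\<^bsub>M\<^esub>"
  using smult_l_distr[of \<zero> \<zero> x] smult_closed[of \<zero> x]
  by (metis M.add.r_cancel_one' R.zero_closed R.l_zero)

lemma smult_r_null [simp]: "a \<in> carrier R \<Longrightarrow> a \<odot>\<^bsub>M\<^esub> \<zero>\<^bsub>M\<^esub> = \<zero>\<^bsub>M\<^esub>"
  using smult_r_distr[of a "\<zero>\<^bsub>M\<^esub>" "\<zero>\<^bsub>M\<^esub>"] smult_closed[of a "\<zero>\<^bsub>M\<^esub>"]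
  by (metis M.add.r_cancel_one' M.zero_closed M.l_zero)

lemma smult_l_minus: "a \<in> carrier R \<Longrightarrow> x \<in> carrier M \<Longrightarrow> (\<ominus> a) \<odot>\<^bsub>M\<^esub> x = \<ominus>\<^bsub>M\<^esub> (a \<odot>\<^bsub>M\<^esub> x)"
  using smult_l_distr[of "\<ominus> a" a x] smult_closed[of a x] smult_closed[of "\<ominus> a" x]
  by (metis M.minus_equality R.a_inv_closed R.l_neg smult_l_null)

text \<open>Negatives are multiples by \<open>\<ominus> \<one>\<close>, so closure under addition
  and scalars is enough.\<close>

lemma submoduleI:
  assumes "H \<subseteq> carrier M" "\<zero>\<^bsub>M\<^esub> \<in> H"
    and "\<And>x y. x \<in> H \<Longrightarrow> y \<in> H \<Longrightarrow> x \<oplus>\<^bsub>M\<^esub> y \<in> H"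
    and smult: "\<And>a x. a \<in> carrier R \<Longrightarrow> x \<in> H \<Longrightarrow> a \<odot>\<^bsub>M\<^esub> x \<in> H"
  shows "submodule H R M"
proof -
  have "\<ominus>\<^bsub>M\<^esub> x \<in> H" if "x \<in> H" for x
    using smult[of "\<ominus> \<one>" x] that assms(1) smult_l_minus[of \<one> x] smult_one[of x] by auto
  then show ?thesis
    by (intro submodule.intro subgroup.intro submodule_axioms.intro) (use assms in \<open>auto simp: a_inv_def\<close>)
qed

lemma submodule_zero: "submodule H R M \<Longrightarrow> \<zero>\<^bsub>M\<^esub> \<in> H"
  using subgroup.one_closed[OF submodule.axioms(1)] by simp

lemma submodule_minus: "submodule H R M \<Longrightarrow> x \<in> H \<Longrightarrow> \<ominus>\<^bsub>M\<^esub> x \<in> H"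
  using subgroup.m_inv_closed[OF submodule.axioms(1)] by (simp add: a_inv_def)

lemma submodule_carrier: "submodule H R M \<Longrightarrow> x \<in> H \<Longrightarrow> x \<in> carrier M"
  using submodule_subset by blast

lemma submodule_add_cancel:
  assumes "submodule H R M" "x \<oplus>\<^bsub>M\<^esub> y \<in> H" "x \<in> H" "y \<in> carrier M"
  shows "y \<in> H"
proof -
  have "y = \<ominus>\<^bsub>M\<^esub> x \<oplus>\<^bsub>M\<^esub> (x \<oplus>\<^bsub>M\<^esub> y)"
    using assms submodule_carrier by (simp add: M.r_neg1)
  then show ?thesis
    using assms submodule_add submodule_minus by metis
qed

lemma zero_submodule: "submodule {\<zero>\<^bsub>M\<^esub>} R M"
  by (rule submoduleI) auto

lemma carrier_submodule: "submodule (carrier M) R M"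
  by (rule submoduleI) (auto intro: smult_closed)

lemma set_add_iff: "x \<in> A <+>\<^bsub>M\<^esub> B \<longleftrightarrow> (\<exists>a\<in>A. \<exists>b\<in>B. x = a \<oplus>\<^bsub>M\<^esub> b)"
  by (auto simp: set_add_def')

lemma set_addI: "a \<in> A \<Longrightarrow> b \<in> B \<Longrightarrow> a \<oplus>\<^bsub>M\<^esub> b \<in> A <+>\<^bsub>M\<^esub> B"
  by (auto simp: set_add_iff)

lemma set_add_submodule:
  assumes A: "submodule A R M" and B: "submodule B R M"
  shows "submodule (A <+>\<^bsub>M\<^esub> B) R M"
proof (rule submoduleI)
  show "A <+>\<^bsub>M\<^esub> B \<subseteq> carrier M"
    using submodule_carrier assms by (auto simp: set_add_iff)
  show "\<zero>\<^bsub>M\<^esub> \<in> A <+>\<^bsub>M\<^esub> B"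
    using submodule_zero[OF A] submodule_zero[OF B] by (force simp: set_add_iff)
next
  fix x y assume "x \<in> A <+>\<^bsub>M\<^esub> B" "y \<in> A <+>\<^bsub>M\<^esub> B"
  then obtain a b a' b' where *: "a \<in> A" "b \<in> B" "a' \<in> A" "b' \<in> B"
    and "x = a \<oplus>\<^bsub>M\<^esub> b" "y = a' \<oplus>\<^bsub>M\<^esub> b'"
    by (auto simp: set_add_iff)
  then have "x \<oplus>\<^bsub>M\<^esub> y = (a \<oplus>\<^bsub>M\<^esub> a') \<oplus>\<^bsub>M\<^esub> (b \<oplus>\<^bsub>M\<^esub> b')"
    using submodule_carrier[OF A] submodule_carrier[OF B] by (simp add: M.a_ac)
  then show "x \<oplus>\<^bsub>M\<^esub> y \<in> A <+>\<^bsub>M\<^esub> B"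
    using * submodule_add[OF A] submodule_add[OF B] by (auto intro: set_addI)
next
  fix r x assume r: "r \<in> carrier R" and "x \<in> A <+>\<^bsub>M\<^esub> B"
  then obtain a b where *: "a \<in> A" "b \<in> B" "x = a \<oplus>\<^bsub>M\<^esub> b"
    by (auto simp: set_add_iff)
  then have "r \<odot>\<^bsub>M\<^esub> x = r \<odot>\<^bsub>M\<^esub> a \<oplus>\<^bsub>M\<^esub> r \<odot>\<^bsub>M\<^esub> b"
    using r submodule_carrier[OF A] submodule_carrier[OF B] by (simp add: smult_r_distr)
  then show "r \<odot>\<^bsub>M\<^esub> x \<in> A <+>\<^bsub>M\<^esub> B"
    using * r submodule_smult[OF A] submodule_smult[OF B] by (auto intro: set_addI)
qed

lemma set_add_upper:
  assumes "submodule A R M" "submodule B R M"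
  shows "A \<subseteq> A <+>\<^bsub>M\<^esub> B" "B \<subseteq> A <+>\<^bsub>M\<^esub> B"
proof -
  have "x \<in> A <+>\<^bsub>M\<^esub> B" if "x \<in> A" for x
    using set_addI[OF that submodule_zero[OF assms(2)]] submodule_carrier[OF assms(1) that] by simp
  then show "A \<subseteq> A <+>\<^bsub>M\<^esub> B" by blast
  have "x \<in> A <+>\<^bsub>M\<^esub> B" if "x \<in> B" for x
    using set_addI[OF submodule_zero[OF assms(1)] that] submodule_carrier[OF assms(2) that] by simp
  then show "B \<subseteq> A <+>\<^bsub>M\<^esub> B" by blast
qed

lemma set_add_least:
  assumes "submodule C R M" "A \<subseteq> C" "B \<subseteq> C"
  shows "A <+>\<^bsub>M\<^esub> B \<subseteq> C"
  using assms submodule_add by (fastforce simp: set_add_iff)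

section \<open>Generated submodules, sums and cyclic submodules\<close>

lemma generate_least:
  assumes "submodule H R M" "G \<subseteq> H"
  shows "generate (add_monoid M) G \<subseteq> H"
  using group.generate_subgroup_incl[OF M.a_group assms(2) submodule.axioms(1)[OF assms(1)]] .

text \<open>Both \<open>submodule_sum\<close> and \<open>MJ\<close> are generated as additive
  groups. Their generating sets absorb scalars, and scalars distribute over sums and
  negatives.\<close>

lemma generate_submodule:
  assumes G: "G \<subseteq> carrier M" and smult: "\<And>a x. a \<in> carrier R \<Longrightarrow> x \<in> G \<Longrightarrow> a \<odot>\<^bsub>M\<^esub> x \<in> G"
  shows "submodule (generate (add_monoid M) G) R M"
proof -
  let ?H = "generate (add_monoid M) G"
  have sub: "subgroup ?H (add_monoid M)"
    using group.generate_is_subgroup[OF M.a_group] G by simp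
  have car: "?H \<subseteq> carrier M"
    using subgroup.subset[OF sub] by simp
  have "a \<odot>\<^bsub>M\<^esub> x \<in> ?H" if a: "a \<in> carrier R" and x: "x \<in> ?H" for a x
    using x
  proof induction
    case one
    show ?case using a generate.one[of "add_monoid M" G] by simp
  next
    case (incl h)
    show ?case by (intro generate.incl smult a incl)
  next
    case (inv h)
    have "a \<odot>\<^bsub>M\<^esub> (\<ominus>\<^bsub>M\<^esub> h) = \<ominus>\<^bsub>M\<^esub> (a \<odot>\<^bsub>M\<^esub> h)"
    proof -
      have h: "h \<in> carrier M" using inv G by blast
      have "a \<odot>\<^bsub>M\<^esub> (\<ominus>\<^bsub>M\<^esub> h) \<oplus>\<^bsub>M\<^esub> a \<odot>\<^bsub>M\<^esub> h = \<zero>\<^bsub>M\<^esub>"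
        using smult_r_distr[of a "\<ominus>\<^bsub>M\<^esub> h" h] a h by (simp add: M.l_neg)
      then show ?thesis
        using a h smult_closed by (metis M.a_inv_closed M.minus_equality)
    qed
    then show ?case
      using generate.inv[OF smult[OF a inv], of "add_monoid M"] by (simp add: a_inv_def)
  next
    case (eng h1 h2)
    then have "h1 \<in> carrier M" "h2 \<in> carrier M" using car by auto
    then show ?case
      using generate.eng[OF eng(3,4)] a by (simp add: smult_r_distr)
  qed
  then show ?thesis
    by (intro submodule.intro submodule_axioms.intro sub)
qed

lemma submodule_sum_submodule:
  assumes "\<And>A. A \<in> F \<Longrightarrow> submodule A R M"
  shows "submodule (submodule_sum M F) R M"
  unfolding submodule_sum_def
proof (rule generate_submodule)
  show "\<Union>F \<subseteq> carrier M" by (meson Union_least assms submodule_subset)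
  show "a \<odot>\<^bsub>M\<^esub> x \<in> \<Union>F" if "a \<in> carrier R" "x \<in> \<Union>F" for a x
    using that by (meson UnionE UnionI assms submodule_smult)
qed

lemma submodule_sum_upper: "A \<in> F \<Longrightarrow> A \<subseteq> submodule_sum M F"
  unfolding submodule_sum_def by (blast intro: generate.incl)

lemma submodule_sum_least:
  assumes "submodule H R M" "\<And>A. A \<in> F \<Longrightarrow> A \<subseteq> H"
  shows "submodule_sum M F \<subseteq> H"
  unfolding submodule_sum_def using assms by (intro generate_least) auto

lemma cyclic_submodule:
  assumes x: "x \<in> carrier M"
  shows "submodule ((\<lambda>r. r \<odot>\<^bsub>M\<^esub> x) ` carrier R) R M"
proof (rule submoduleI)
  show "(\<lambda>r. r \<odot>\<^bsub>M\<^esub> x) ` carrier R \<subseteq> carrier M"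
    using x smult_closed by auto
  show "\<zero>\<^bsub>M\<^esub> \<in> (\<lambda>r. r \<odot>\<^bsub>M\<^esub> x) ` carrier R"
    using smult_l_null[OF x] by (metis imageI R.zero_closed)
next
  fix y z assume "y \<in> (\<lambda>r. r \<odot>\<^bsub>M\<^esub> x) ` carrier R" "z \<in> (\<lambda>r. r \<odot>\<^bsub>M\<^esub> x) ` carrier R"
  then obtain r s where "r \<in> carrier R" "s \<in> carrier R" "y = r \<odot>\<^bsub>M\<^esub> x" "z = s \<odot>\<^bsub>M\<^esub> x"
    by auto
  then show "y \<oplus>\<^bsub>M\<^esub> z \<in> (\<lambda>r. r \<odot>\<^bsub>M\<^esub> x) ` carrier R"
    using smult_l_distr x by (intro image_eqI[of _ _ "r \<oplus> s"]) auto
next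
  fix a y assume "a \<in> carrier R" "y \<in> (\<lambda>r. r \<odot>\<^bsub>M\<^esub> x) ` carrier R"
  then obtain r where "a \<in> carrier R" "r \<in> carrier R" "y = r \<odot>\<^bsub>M\<^esub> x"
    by auto
  then show "a \<odot>\<^bsub>M\<^esub> y \<in> (\<lambda>r. r \<odot>\<^bsub>M\<^esub> x) ` carrier R"
    using smult_assoc x by (intro image_eqI[of _ _ "r \<otimes> a"]) auto
qed

lemma self_in_cyclic: "x \<in> carrier M \<Longrightarrow> x \<in> (\<lambda>r. r \<odot>\<^bsub>M\<^esub> x) ` carrier R"
  using smult_one by (metis imageI R.one_closed)

section \<open>Simple submodules and the existence of complements\<close>

lemma simple_submodule_cyclic:
  assumes A: "simple_submodule R M A" and x: "x \<in> A" "x \<noteq> \<zero>\<^bsub>M\<^esub>"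
  shows "(\<lambda>r. r \<odot>\<^bsub>M\<^esub> x) ` carrier R = A"
proof -
  have sub: "submodule A R M" using A by (simp add: simple_submodule_def)
  then have xM: "x \<in> carrier M" using x submodule_carrier by blast
  have "(\<lambda>r. r \<odot>\<^bsub>M\<^esub> x) ` carrier R \<subseteq> A"
    using x submodule_smult[OF sub] by auto
  then show ?thesis
    using A cyclic_submodule[OF xM] self_in_cyclic[OF xM] x(2) unfolding simple_submodule_def by blast
qed

lemma simple_submodule_meet:
  assumes "simple_submodule R M A" "submodule D R M" "\<not> A \<subseteq> D"
  shows "A \<inter> D = {\<zero>\<^bsub>M\<^esub>}"
proof -
  have A: "submodule A R M" using assms(1) by (simp add: simple_submodule_def)
  have "submodule (A \<inter> D) R M"
    by (rule submoduleI)
      (use A assms(2) submodule_carrier submodule_zero submodule_add submodule_smult in auto)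
  then show ?thesis
    using assms unfolding simple_submodule_def by blast
qed

text \<open>The last hypothesis says, without forming quotients, that every proper submodule of \<open>M / N\<^sub>0\<close>
  meets some nonzero submodule trivially.\<close>

lemma complement_exists:
  assumes A: "submodule A R M" and N0: "submodule N\<^sub>0 R M" and AN0: "N\<^sub>0 \<inter> A = {\<zero>\<^bsub>M\<^esub>}"
    and X: "\<And>D. submodule D R M \<Longrightarrow> N\<^sub>0 \<subseteq> D \<Longrightarrow> D \<noteq> carrier M \<Longrightarrow>
      \<exists>X. submodule X R M \<and> \<not> X \<subseteq> D \<and> X \<inter> D \<subseteq> N\<^sub>0"
  shows "direct_summand R M A"
proof -
  \<comment> \<open>Keeping \<open>N\<^sub>0\<close> below every candidate ensures that the
    hypothesis on \<open>D\<close> applies to \<open>A + N\<close> for a maximal \<open>N\<close>,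
    and that \<open>X \<inter> D\<close> falls into \<open>N\<close>.\<close>
  define \<A> where "\<A> = {N. submodule N R M \<and> N\<^sub>0 \<subseteq> N \<and> N \<inter> A = {\<zero>\<^bsub>M\<^esub>}}"
  have "\<exists>N\<in>\<A>. \<forall>X\<in>\<A>. N \<subseteq> X \<longrightarrow> X = N"
  proof (rule subset_Zorn_nonempty)
    show "\<A> \<noteq> {}" using N0 AN0 by (auto simp: \<A>_def)
    fix \<C> assume ne: "\<C> \<noteq> {}" and ch: "subset.chain \<A> \<C>"
    then have sub: "submodule N R M" "N\<^sub>0 \<subseteq> N" "N \<inter> A = {\<zero>\<^bsub>M\<^esub>}" if "N \<in> \<C>" for N
      using that by (auto simp: subset.chain_def \<A>_def)
    have "submodule (\<Union>\<C>) R M"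
    proof (rule submoduleI)
      show "\<Union>\<C> \<subseteq> carrier M" using sub(1) submodule_carrier by blast
      show "\<zero>\<^bsub>M\<^esub> \<in> \<Union>\<C>" using sub(1) submodule_zero ne by blast
      show "a \<odot>\<^bsub>M\<^esub> x \<in> \<Union>\<C>" if "a \<in> carrier R" "x \<in> \<Union>\<C>" for a x
        using that by (meson UnionE UnionI submodule_smult sub(1))
      fix x y assume "x \<in> \<Union>\<C>" "y \<in> \<Union>\<C>"
      then obtain X Y where XY: "X \<in> \<C>" "x \<in> X" "Y \<in> \<C>" "y \<in> Y" by blast
      have "X \<subseteq> Y \<or> Y \<subseteq> X" using ch XY(1,3) by (auto simp: subset.chain_def)
      then show "x \<oplus>\<^bsub>M\<^esub> y \<in> \<Union>\<C>"
      proof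
        assume "X \<subseteq> Y"
        then show ?thesis using submodule_add[OF sub(1)[OF XY(3)], of x y] XY by blast
      next
        assume "Y \<subseteq> X"
        then show ?thesis using submodule_add[OF sub(1)[OF XY(1)], of x y] XY by blast
      qed
    qed
    moreover have "\<Union>\<C> \<inter> A = {\<zero>\<^bsub>M\<^esub>}" using sub(3) ne by blast
    ultimately show "\<Union>\<C> \<in> \<A>" using sub(2) ne by (auto simp: \<A>_def)
  qed
  then obtain N where N: "submodule N R M" "N\<^sub>0 \<subseteq> N" "N \<inter> A = {\<zero>\<^bsub>M\<^esub>}"
    and max: "\<And>X. X \<in> \<A> \<Longrightarrow> N \<subseteq> X \<Longrightarrow> X = N"
    by (auto simp: \<A>_def)
  have "A <+>\<^bsub>M\<^esub> N = carrier M"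
  proof (rule ccontr)
    let ?D = "A <+>\<^bsub>M\<^esub> N"
    assume DM: "?D \<noteq> carrier M"
    have D: "submodule ?D R M" by (rule set_add_submodule[OF A N(1)])
    have ND: "N \<subseteq> ?D" and AD: "A \<subseteq> ?D" by (rule set_add_upper[OF A N(1)])+
    have "N\<^sub>0 \<subseteq> ?D" using N(2) ND by blast
    then obtain X where X: "submodule X R M" "\<not> X \<subseteq> ?D" "X \<inter> ?D \<subseteq> N\<^sub>0"
      using X[OF D _ DM] by blast
    \<comment> \<open>If \<open>a = n + x\<close>, then \<open>x\<close> lies in
      \<open>X \<inter> D\<close>, since \<open>a\<close> and \<open>n\<close> lie in
      \<open>D\<close>. Hence \<open>x\<close> and then \<open>a\<close> lie in \<open>N\<close>,
      which misses \<open>A\<close>.\<close>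
    have "a = \<zero>\<^bsub>M\<^esub>" if a: "a \<in> N <+>\<^bsub>M\<^esub> X" "a \<in> A" for a
    proof -
      obtain n x where nx: "n \<in> N" "x \<in> X" "a = n \<oplus>\<^bsub>M\<^esub> x"
        using a by (auto simp: set_add_iff)
      have "x \<in> ?D"
        by (rule submodule_add_cancel[OF D, of n]) (use nx a AD ND submodule_carrier[OF X(1)] in auto)
      then have "x \<in> N" using X(3) nx N(2) by blast
      then show ?thesis using nx N a submodule_add[OF N(1)] by blast
    qed
    moreover have NX: "submodule (N <+>\<^bsub>M\<^esub> X) R M" "N \<subseteq> N <+>\<^bsub>M\<^esub> X" "X \<subseteq> N <+>\<^bsub>M\<^esub> X"
      by (rule set_add_submodule[OF N(1) X(1)] set_add_upper[OF N(1) X(1)])+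
    ultimately have "(N <+>\<^bsub>M\<^esub> X) \<inter> A = {\<zero>\<^bsub>M\<^esub>}"
      using submodule_zero[OF NX(1)] submodule_zero[OF A] by blast
    then have "N <+>\<^bsub>M\<^esub> X \<in> \<A>"
      using N(2) NX(1,2) unfolding \<A>_def by simp
    \<comment> \<open>So \<open>N + X\<close> is a candidate as well, and maximality forces
      \<open>X\<close> into \<open>N\<close> and thereby into \<open>D\<close>.\<close>
    from max[OF this NX(2)] have "X \<subseteq> N" using NX(3) by simp
    then show False using ND X(2) by blast
  qed
  then show ?thesis
    using A N unfolding direct_summand_def internal_direct_sum_def by blast
qed


section \<open>Homomorphisms\<close>

lemma mod_hom_restrict:
  "f \<in> mod_hom R M M \<Longrightarrow> submodule A R M \<Longrightarrow> f \<in> mod_hom R (M\<lparr>carrier := A\<rparr>) M"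
  using submodule_carrier by (auto simp: mod_hom_def Pi_iff)

lemma mod_hom_zero:
  assumes "submodule A R M" "f \<in> mod_hom R (M\<lparr>carrier := A\<rparr>) M"
  shows "f \<zero>\<^bsub>M\<^esub> = \<zero>\<^bsub>M\<^esub>"
proof -
  have z: "\<zero>\<^bsub>M\<^esub> \<in> A" by (rule submodule_zero[OF assms(1)])
  \<comment> \<open>\<open>mod_hom\<close> does not list preservation of zero; compatibility with
    the scalar 0 supplies it.\<close>
  then have "f (\<zero> \<odot>\<^bsub>M\<^esub> \<zero>\<^bsub>M\<^esub>) = \<zero> \<odot>\<^bsub>M\<^esub> f \<zero>\<^bsub>M\<^esub>" "f \<zero>\<^bsub>M\<^esub> \<in> carrier M"
    using assms(2) R.zero_closed by (auto simp: mod_hom_def simp del: smult_l_null smult_r_null)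
  then show ?thesis by simp
qed

lemma mod_hom_image:
  assumes A: "submodule A R M" and f: "f \<in> mod_hom R (M\<lparr>carrier := A\<rparr>) M"
  shows "submodule (f ` A) R M"
proof (rule submoduleI)
  show "f ` A \<subseteq> carrier M" using f by (auto simp: mod_hom_def)
  show "\<zero>\<^bsub>M\<^esub> \<in> f ` A" using mod_hom_zero[OF A f] submodule_zero[OF A] by (metis imageI)
  show "x \<oplus>\<^bsub>M\<^esub> y \<in> f ` A" if "x \<in> f ` A" "y \<in> f ` A" for x y
  proof -
    obtain a b where "a \<in> A" "b \<in> A" "x = f a" "y = f b" using \<open>x \<in> f ` A\<close> \<open>y \<in> f ` A\<close> by auto
    then show ?thesis
      using f submodule_add[OF A] by (intro image_eqI[of _ _ "a \<oplus>\<^bsub>M\<^esub> b"]) (auto simp: mod_hom_def)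
  qed
  show "r \<odot>\<^bsub>M\<^esub> x \<in> f ` A" if r: "r \<in> carrier R" and "x \<in> f ` A" for r x
  proof -
    obtain a where "a \<in> A" "x = f a" using \<open>x \<in> f ` A\<close> by auto
    then show ?thesis
      using r f submodule_smult[OF A] by (intro image_eqI[of _ _ "r \<odot>\<^bsub>M\<^esub> a"]) (auto simp: mod_hom_def)
  qed
qed

lemma mod_hom_preimage:
  assumes A: "submodule A R M" and f: "f \<in> mod_hom R (M\<lparr>carrier := A\<rparr>) M" and B: "submodule B R M"
  shows "submodule {a \<in> A. f a \<in> B} R M"
proof (rule submoduleI)
  show "{a \<in> A. f a \<in> B} \<subseteq> carrier M" using submodule_carrier[OF A] by auto
  show "\<zero>\<^bsub>M\<^esub> \<in> {a \<in> A. f a \<in> B}"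
    using mod_hom_zero[OF A f] submodule_zero[OF A] submodule_zero[OF B] by simp
  show "x \<oplus>\<^bsub>M\<^esub> y \<in> {a \<in> A. f a \<in> B}" if "x \<in> {a \<in> A. f a \<in> B}" "y \<in> {a \<in> A. f a \<in> B}" for x y
    using that f submodule_add[OF A] submodule_add[OF B] by (auto simp: mod_hom_def)
  show "r \<odot>\<^bsub>M\<^esub> x \<in> {a \<in> A. f a \<in> B}" if "r \<in> carrier R" "x \<in> {a \<in> A. f a \<in> B}" for r x
    using that f submodule_smult[OF A] submodule_smult[OF B] by (auto simp: mod_hom_def)
qed

lemma simple_submodule_image:
  assumes A: "simple_submodule R M A" and f: "f \<in> mod_hom R (M\<lparr>carrier := A\<rparr>) M"
    and nz: "f ` A \<noteq> {\<zero>\<^bsub>M\<^esub>}"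
  shows "simple_submodule R M (f ` A)"
    and "mod_isomorphic R (M\<lparr>carrier := f ` A\<rparr>) (M\<lparr>carrier := A\<rparr>)"
proof -
  have sub: "submodule A R M" using A by (simp add: simple_submodule_def)
  have pre: "{a \<in> A. f a \<in> B} = {\<zero>\<^bsub>M\<^esub>} \<or> {a \<in> A. f a \<in> B} = A" if "submodule B R M" for B
    using A mod_hom_preimage[OF sub f that] unfolding simple_submodule_def by blast
  show "simple_submodule R M (f ` A)"
    unfolding simple_submodule_def
  proof (intro conjI allI impI)
    fix B assume B: "submodule B R M \<and> B \<subseteq> f ` A"
    then have im: "B = f ` {a \<in> A. f a \<in> B}" by auto
    from B have "submodule B R M" by simp
    from pre[OF this] show "B = {\<zero>\<^bsub>M\<^esub>} \<or> B = f ` A"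
    proof
      assume "{a \<in> A. f a \<in> B} = {\<zero>\<^bsub>M\<^esub>}"
      then show ?thesis using im mod_hom_zero[OF sub f] by simp
    next
      assume "{a \<in> A. f a \<in> B} = A"
      then show ?thesis using im by simp
    qed
  qed (use mod_hom_image[OF sub f] nz in auto)
  have ker: "a = \<zero>\<^bsub>M\<^esub>" if "a \<in> A" "f a = \<zero>\<^bsub>M\<^esub>" for a
  proof -
    have "{a \<in> A. f a \<in> {\<zero>\<^bsub>M\<^esub>}} \<noteq> A"
      using nz submodule_zero[OF sub] mod_hom_zero[OF sub f] by force
    then have "{a \<in> A. f a \<in> {\<zero>\<^bsub>M\<^esub>}} = {\<zero>\<^bsub>M\<^esub>}" using pre[OF zero_submodule] by blast
    then show ?thesis using that by blast
  qed
  have f_add: "f (a \<oplus>\<^bsub>M\<^esub> b) = f a \<oplus>\<^bsub>M\<^esub> f b" if "a \<in> A" "b \<in> A" for a b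
    using f that by (simp add: mod_hom_def)
  have f_smult: "f (r \<odot>\<^bsub>M\<^esub> a) = r \<odot>\<^bsub>M\<^esub> f a" if "r \<in> carrier R" "a \<in> A" for r a
    using f that by (simp add: mod_hom_def)
  have fM: "f a \<in> carrier M" if "a \<in> A" for a
    using f that by (auto simp: mod_hom_def)
  have inj: "inj_on f A"
  proof (rule inj_onI)
    fix a b assume ab: "a \<in> A" "b \<in> A" "f a = f b"
    have "f (\<ominus>\<^bsub>M\<^esub> b) \<oplus>\<^bsub>M\<^esub> f b = \<zero>\<^bsub>M\<^esub>"
      using f_add[of "\<ominus>\<^bsub>M\<^esub> b" b] ab submodule_minus[OF sub] submodule_carrier[OF sub]
      by (simp add: M.l_neg mod_hom_zero[OF sub f])
    then have "f (\<ominus>\<^bsub>M\<^esub> b \<oplus>\<^bsub>M\<^esub> a) = \<zero>\<^bsub>M\<^esub>"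
      using f_add[of "\<ominus>\<^bsub>M\<^esub> b" a] ab submodule_minus[OF sub] by simp
    then have "\<ominus>\<^bsub>M\<^esub> b \<oplus>\<^bsub>M\<^esub> a = \<zero>\<^bsub>M\<^esub>"
      using ker ab submodule_minus[OF sub] submodule_add[OF sub] by blast
    then show "a = b"
      using ab submodule_carrier[OF sub]
      by (metis M.a_inv_closed M.minus_equality M.minus_minus M.a_comm)
  qed
  have bij: "bij_betw (inv_into A f) (f ` A) A"
    using inj by (simp add: bij_betw_inv_into bij_betw_def inj_on_inv_into)
  have "inv_into A f \<in> mod_hom R (M\<lparr>carrier := f ` A\<rparr>) (M\<lparr>carrier := A\<rparr>)"
    using inj submodule_add[OF sub] submodule_smult[OF sub]
    by (auto simp: mod_hom_def f_add[symmetric] f_smult[symmetric])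
  then show "mod_isomorphic R (M\<lparr>carrier := f ` A\<rparr>) (M\<lparr>carrier := A\<rparr>)"
    using bij unfolding mod_isomorphic_def by auto
qed

end


section \<open>The Jacobson radical\<close>

text \<open>The submodule \<open>MJ\<close>. Additive generation suffices, as
  \<open>(x a) r = x (a r)\<close> and \<open>J\<close> absorbs factors on the right.\<close>

definition radical_submodule :: "('r, 'x) ring_scheme \<Rightarrow> ('r, 'm, 'y) module_scheme \<Rightarrow> 'm set" where
  "radical_submodule R M =
     generate (add_monoid M) {a \<odot>\<^bsub>M\<^esub> x | a x. a \<in> jacobson_radical R \<and> x \<in> carrier M}"

lemma right_regular_simps [simp]:
  "carrier (right_regular R) = carrier R" "\<zero>\<^bsub>right_regular R\<^esub> = \<zero>\<^bsub>R\<^esub>"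
  "x \<oplus>\<^bsub>right_regular R\<^esub> y = x \<oplus>\<^bsub>R\<^esub> y" "a \<odot>\<^bsub>right_regular R\<^esub> x = x \<otimes>\<^bsub>R\<^esub> a"
  by (simp_all add: right_regular_def)

lemma (in ring) right_module_right_regular: "right_module R (right_regular R)"
proof -
  have "abelian_group (right_regular R)"
  proof (rule abelian_groupI)
    fix x assume "x \<in> carrier (right_regular R)"
    then show "\<exists>y \<in> carrier (right_regular R). y \<oplus>\<^bsub>right_regular R\<^esub> x = \<zero>\<^bsub>right_regular R\<^esub>"
      by (intro bexI[of _ "\<ominus> x"]) (simp_all add: l_neg)
  qed (simp_all add: a_ac)
  then show ?thesis
    unfolding right_module_def right_module_axioms_def
    using ring_axioms by (simp add: l_distr r_distr m_assoc)
qed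

text \<open>The condition \<open>gen\<close> says that the class of \<open>x\<close> generates a
  simple submodule of \<open>M/N\<close>, and the set is the annihilator of that class. Two
  instances are needed: a maximal right ideal \<open>N\<close> of the regular module, to see that
  \<open>J\<close> is a left ideal, and \<open>N = 0\<close>, to see that \<open>J\<close> kills
  simple submodules.\<close>

lemma (in right_module) annihilator_maximal:
  assumes N: "submodule N R M" and x: "x \<in> carrier M" "x \<notin> N"
    and gen: "\<And>y. y \<in> carrier R \<Longrightarrow> y \<odot>\<^bsub>M\<^esub> x \<notin> N \<Longrightarrow>
      \<exists>n \<in> N. \<exists>t \<in> carrier R. x = n \<oplus>\<^bsub>M\<^esub> t \<odot>\<^bsub>M\<^esub> (y \<odot>\<^bsub>M\<^esub> x)"
  shows "maximal_right_ideal R {r \<in> carrier R. r \<odot>\<^bsub>M\<^esub> x \<in> N}" (is "maximal_right_ideal R ?K")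
  unfolding maximal_right_ideal_def
proof (intro conjI allI impI)
  interpret reg: right_module R "right_regular R" by (rule R.right_module_right_regular)
  show "submodule ?K R (right_regular R)"
    by (rule reg.submoduleI)
      (use x submodule_zero[OF N] submodule_add[OF N] submodule_smult[OF N]
        in \<open>auto simp: smult_l_distr smult_assoc\<close>)
  show "?K \<noteq> carrier R"
    using x smult_one[of x] by force
  fix K' assume "submodule K' R (right_regular R) \<and> ?K \<subseteq> K'"
  then have K': "submodule K' R (right_regular R)" and sub: "?K \<subseteq> K'" by auto
  have K'R: "K' \<subseteq> carrier R" using submodule_subset[OF K'] by simp
  show "K' = ?K \<or> K' = carrier R"
  proof (cases "K' = ?K")
    case False
    then obtain s where s: "s \<in> K'" "s \<in> carrier R" "s \<odot>\<^bsub>M\<^esub> x \<notin> N"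
      using sub K'R by blast
    then obtain n t where nt: "n \<in> N" "t \<in> carrier R" "x = n \<oplus>\<^bsub>M\<^esub> t \<odot>\<^bsub>M\<^esub> (s \<odot>\<^bsub>M\<^esub> x)"
      using gen by blast
    have nM: "n \<in> carrier M" using nt(1) submodule_carrier[OF N] by blast
    \<comment> \<open>From \<open>x = n + x s t\<close> the element \<open>1 - s t\<close> carries
      \<open>x\<close> into \<open>N\<close>, so it lies in \<open>?K\<close>; since
      \<open>s t\<close> is in \<open>K'\<close>, so is \<open>1\<close>.\<close>
    have "(\<one> \<ominus> s \<otimes> t) \<odot>\<^bsub>M\<^esub> x = x \<oplus>\<^bsub>M\<^esub> \<ominus>\<^bsub>M\<^esub> (t \<odot>\<^bsub>M\<^esub> (s \<odot>\<^bsub>M\<^esub> x))"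
      using s nt x by (simp add: a_minus_def smult_l_distr smult_one smult_l_minus smult_assoc)
    also have "\<dots> = n"
      using nM nt(2,3) s(2) x(1) smult_closed
      by (metis M.a_assoc M.a_inv_closed M.r_neg M.r_zero)
    finally have "\<one> \<ominus> s \<otimes> t \<in> ?K" using nt(1,2) s(2) by simp
    then have "\<one> \<ominus> s \<otimes> t \<in> K'" using sub by blast
    moreover have "s \<otimes> t \<in> K'" using submodule_smult[OF K', of t s] nt s by simp
    ultimately have "(\<one> \<ominus> s \<otimes> t) \<oplus> s \<otimes> t \<in> K'" using submodule_add[OF K'] by simp
    then have one: "\<one> \<in> K'" using nt(2) s(2) by (simp add: a_minus_def R.a_assoc R.l_neg)
    have "r \<in> K'" if "r \<in> carrier R" for r
      using submodule_smult[OF K' that one] that by simp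
    then show ?thesis using K'R by blast
  qed simp
qed

text \<open>Only absorption on the left is not immediate. For a maximal right ideal \<open>I\<close>
  and \<open>x\<close> outside \<open>I\<close>, the set of all \<open>r\<close> with
  \<open>x r\<close> in \<open>I\<close> is again a maximal right ideal, so it contains
  \<open>J\<close>.\<close>

lemma (in ring) jacobson_radical_ideal: "ideal (jacobson_radical R) R"
proof (rule idealI)
  interpret reg: right_module R "right_regular R" by (rule right_module_right_regular)
  have maxD: "submodule I R (right_regular R)" "I \<noteq> carrier R"
    "\<And>K. submodule K R (right_regular R) \<Longrightarrow> I \<subseteq> K \<Longrightarrow> K = I \<or> K = carrier R"
    if "maximal_right_ideal R I" for I
    using that by (auto simp: maximal_right_ideal_def)
  have J: "submodule (jacobson_radical R) R (right_regular R)"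
  proof (rule reg.submoduleI)
    show "x \<oplus>\<^bsub>right_regular R\<^esub> y \<in> jacobson_radical R"
      if "x \<in> jacobson_radical R" "y \<in> jacobson_radical R" for x y
      using that submodule_add[OF maxD(1)] by (auto simp: jacobson_radical_def)
    show "a \<odot>\<^bsub>right_regular R\<^esub> x \<in> jacobson_radical R"
      if "a \<in> carrier R" "x \<in> jacobson_radical R" for a x
      using that submodule_smult[OF maxD(1)] by (auto simp: jacobson_radical_def)
  qed (use reg.submodule_zero[OF maxD(1)] in \<open>auto simp: jacobson_radical_def\<close>)
  show "subgroup (jacobson_radical R) (add_monoid R)"
    using submodule.axioms(1)[OF J] by (simp add: right_regular_def subgroup_def m_inv_def)
  show "a \<otimes> x \<in> jacobson_radical R" if "a \<in> jacobson_radical R" "x \<in> carrier R" for a x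
    using submodule_smult[OF J that(2,1)] by simp
  fix a x assume a: "a \<in> jacobson_radical R" and x: "x \<in> carrier R"
  have "x \<otimes> a \<in> I" if I: "maximal_right_ideal R I" for I
  proof (cases "x \<in> I")
    case True
    then show ?thesis
      using submodule_smult[OF maxD(1)[OF I], of a x] a by (simp add: jacobson_radical_def)
  next
    case False
    have "maximal_right_ideal R {r \<in> carrier R. r \<odot>\<^bsub>right_regular R\<^esub> x \<in> I}"
    proof (rule reg.annihilator_maximal[OF maxD(1)[OF I]])
      fix y assume y: "y \<in> carrier R" "y \<odot>\<^bsub>right_regular R\<^esub> x \<notin> I"
      let ?C = "(\<lambda>r. r \<odot>\<^bsub>right_regular R\<^esub> (x \<otimes> y)) ` carrier R"
      have C: "submodule ?C R (right_regular R)" "x \<otimes> y \<in> ?C"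
        using reg.cyclic_submodule[of "x \<otimes> y"] reg.self_in_cyclic[of "x \<otimes> y"] x y by simp_all
      \<comment> \<open>\<open>I\<close> is maximal and \<open>x y\<close> lies outside it, so
        adding the right ideal generated by \<open>x y\<close> gives the whole ring.\<close>
      have "I <+>\<^bsub>right_regular R\<^esub> ?C = carrier R"
        using maxD(3)[OF I reg.set_add_submodule[OF maxD(1)[OF I] C(1)]
            reg.set_add_upper(1)[OF maxD(1)[OF I] C(1)]]
          reg.set_add_upper(2)[OF maxD(1)[OF I] C(1)] C(2) y(2) by auto
      then have "x \<in> I <+>\<^bsub>right_regular R\<^esub> ?C" using x by simp
      then show "\<exists>n\<in>I. \<exists>t\<in>carrier R. x = n \<oplus>\<^bsub>right_regular R\<^esub>
          t \<odot>\<^bsub>right_regular R\<^esub> (y \<odot>\<^bsub>right_regular R\<^esub> x)"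
        unfolding reg.set_add_iff by simp
    qed (use x False in simp_all)
    then show ?thesis
      using a by (auto simp: jacobson_radical_def)
  qed
  then show "x \<otimes> a \<in> jacobson_radical R"
    using a x by (simp add: jacobson_radical_def)
qed (rule ring_axioms)

section \<open>The submodule \<open>MJ\<close> and the semisimplicity of \<open>M/MJ\<close>\<close>

context right_module
begin

text \<open>Every nonzero element of a simple submodule generates it, so the annihilator of such an
  element is a maximal right ideal and contains \<open>J\<close>.\<close>

lemma simple_submodule_jacobson:
  assumes A: "simple_submodule R M A" and a: "a \<in> jacobson_radical R" and x: "x \<in> A"
  shows "a \<odot>\<^bsub>M\<^esub> x = \<zero>\<^bsub>M\<^esub>"
proof (cases "x = \<zero>\<^bsub>M\<^esub>")
  case True
  then show ?thesis using a by (simp add: jacobson_radical_def)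
next
  case False
  have sub: "submodule A R M" using A by (simp add: simple_submodule_def)
  have "maximal_right_ideal R {r \<in> carrier R. r \<odot>\<^bsub>M\<^esub> x \<in> {\<zero>\<^bsub>M\<^esub>}}"
  proof (rule annihilator_maximal[OF zero_submodule])
    fix y assume y: "y \<in> carrier R" "y \<odot>\<^bsub>M\<^esub> x \<notin> {\<zero>\<^bsub>M\<^esub>}"
    have yx: "y \<odot>\<^bsub>M\<^esub> x \<in> A" by (rule submodule_smult[OF sub y(1) x])
    have "x \<in> (\<lambda>r. r \<odot>\<^bsub>M\<^esub> (y \<odot>\<^bsub>M\<^esub> x)) ` carrier R"
      using simple_submodule_cyclic[OF A yx] y(2) x by simp
    then obtain t where t: "t \<in> carrier R" "x = t \<odot>\<^bsub>M\<^esub> (y \<odot>\<^bsub>M\<^esub> x)" by blast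
    then have "x = \<zero>\<^bsub>M\<^esub> \<oplus>\<^bsub>M\<^esub> t \<odot>\<^bsub>M\<^esub> (y \<odot>\<^bsub>M\<^esub> x)"
      using submodule_carrier[OF sub x] by simp
    with t(1) show "\<exists>n\<in>{\<zero>\<^bsub>M\<^esub>}. \<exists>t\<in>carrier R. x = n \<oplus>\<^bsub>M\<^esub> t \<odot>\<^bsub>M\<^esub> (y \<odot>\<^bsub>M\<^esub> x)"
      by blast
  qed (use False submodule_carrier[OF sub x] in simp_all)
  then show ?thesis
    using a by (auto simp: jacobson_radical_def)
qed

lemma radical_submodule_submodule: "submodule (radical_submodule R M) R M"
  unfolding radical_submodule_def
proof (rule generate_submodule)
  interpret J: ideal "jacobson_radical R" R by (rule R.jacobson_radical_ideal)
  show "{a \<odot>\<^bsub>M\<^esub> x |a x. a \<in> jacobson_radical R \<and> x \<in> carrier M} \<subseteq> carrier M"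
    using smult_closed J.a_Hcarr by auto
  fix r y assume r: "r \<in> carrier R"
    and "y \<in> {a \<odot>\<^bsub>M\<^esub> x |a x. a \<in> jacobson_radical R \<and> x \<in> carrier M}"
  then obtain a x where ax: "y = a \<odot>\<^bsub>M\<^esub> x" "a \<in> jacobson_radical R" "x \<in> carrier M" by blast
  then have "r \<odot>\<^bsub>M\<^esub> y = (a \<otimes> r) \<odot>\<^bsub>M\<^esub> x"
    using r J.a_Hcarr by (simp add: smult_assoc)
  then show "r \<odot>\<^bsub>M\<^esub> y \<in> {a \<odot>\<^bsub>M\<^esub> x |a x. a \<in> jacobson_radical R \<and> x \<in> carrier M}"
    using ax J.I_r_closed[OF ax(2) r] by blast
qed

lemma radical_submoduleI:
  "a \<in> jacobson_radical R \<Longrightarrow> x \<in> carrier M \<Longrightarrow> a \<odot>\<^bsub>M\<^esub> x \<in> radical_submodule R M"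
  unfolding radical_submodule_def by (rule generate.incl) blast

text \<open>If \<open>M = A + N\<close> and \<open>AJ = 0\<close>, then \<open>MJ = NJ\<close> lies
  in \<open>N\<close>, which misses \<open>A\<close>.\<close>

lemma direct_summand_radical:
  assumes A: "direct_summand R M A"
    and null: "\<And>a x. a \<in> jacobson_radical R \<Longrightarrow> x \<in> A \<Longrightarrow> a \<odot>\<^bsub>M\<^esub> x = \<zero>\<^bsub>M\<^esub>"
  shows "A \<inter> radical_submodule R M = {\<zero>\<^bsub>M\<^esub>}"
proof -
  obtain N where N: "submodule A R M" "submodule N R M" "A <+>\<^bsub>M\<^esub> N = carrier M" "A \<inter> N = {\<zero>\<^bsub>M\<^esub>}"
    using A by (auto simp: direct_summand_def internal_direct_sum_def)
  have "a \<odot>\<^bsub>M\<^esub> x \<in> N" if a: "a \<in> jacobson_radical R" and x: "x \<in> carrier M" for a x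
  proof -
    have aR: "a \<in> carrier R" using a by (simp add: jacobson_radical_def)
    obtain y n where yn: "y \<in> A" "n \<in> N" "x = y \<oplus>\<^bsub>M\<^esub> n" using x N(3) set_add_iff by blast
    then have "a \<odot>\<^bsub>M\<^esub> x = a \<odot>\<^bsub>M\<^esub> n"
      using aR null[OF a] submodule_carrier[OF N(1)] submodule_carrier[OF N(2)]
      by (simp add: smult_r_distr smult_closed)
    then show ?thesis using submodule_smult[OF N(2) aR yn(2)] by simp
  qed
  then have "radical_submodule R M \<subseteq> N"
    unfolding radical_submodule_def by (intro generate_least[OF N(2)]) blast
  then show ?thesis
    using N(4) submodule_zero[OF N(1)] submodule_zero[OF radical_submodule_submodule] by blast
qed

text \<open>For \<open>m\<close> outside \<open>D\<close>, the map
  \<open>r + J \<mapsto> m r + D\<close> from \<open>R/J\<close> to \<open>M/D\<close> is nonzero.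
  As \<open>R/J\<close> is a sum of simple right ideals, one of them is not killed, and its image
  under multiplication by \<open>m\<close> yields \<open>X\<close>.\<close>

lemma semilocal_not_below:
  assumes R: "semilocal R" and D: "submodule D R M" "radical_submodule R M \<subseteq> D" "D \<noteq> carrier M"
  shows "\<exists>X. submodule X R M \<and> \<not> X \<subseteq> D \<and> X \<inter> D \<subseteq> radical_submodule R M"
proof -
  let ?J = "jacobson_radical R" and ?MJ = "radical_submodule R M"
  let ?Q = "R Quot ?J"
  interpret J: ideal ?J R by (rule R.jacobson_radical_ideal)
  interpret Q: right_module ?Q "right_regular ?Q"
    by (rule ring.right_module_right_regular[OF J.quotient_is_ring])
  have Q: "carrier ?Q = (+>) ?J ` carrier R" "\<zero>\<^bsub>?Q\<^esub> = ?J" "\<one>\<^bsub>?Q\<^esub> = ?J +> \<one>"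
    "\<And>r s. r \<in> carrier R \<Longrightarrow> s \<in> carrier R \<Longrightarrow> (?J +> r) \<oplus>\<^bsub>?Q\<^esub> (?J +> s) = ?J +> (r \<oplus> s)"
    "\<And>r s. r \<in> carrier R \<Longrightarrow> s \<in> carrier R \<Longrightarrow> (?J +> r) \<otimes>\<^bsub>?Q\<^esub> (?J +> s) = ?J +> (r \<otimes> s)"
    by (auto simp: FactRing_simps J.a_rcos_sum J.rcoset_mult_add)
  obtain m where m: "m \<in> carrier M" "m \<notin> D" using D submodule_subset by blast
  \<comment> \<open>The kernel of that map. Membership does not depend on the representative, since
    \<open>m J\<close> lies in \<open>MJ\<close> and hence in \<open>D\<close>.\<close>
  define H where "H = (+>) ?J ` {r \<in> carrier R. r \<odot>\<^bsub>M\<^esub> m \<in> D}"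
  have H_iff: "?J +> r \<in> H \<longleftrightarrow> r \<odot>\<^bsub>M\<^esub> m \<in> D" if r: "r \<in> carrier R" for r
  proof
    assume "?J +> r \<in> H"
    then obtain s where s: "s \<in> carrier R" "s \<odot>\<^bsub>M\<^esub> m \<in> D" "?J +> r = ?J +> s"
      by (auto simp: H_def)
    then have "r \<in> ?J +> s" using J.a_rcos_self[OF r] by simp
    then obtain j where j: "j \<in> ?J" "r = j \<oplus> s" by (auto simp: a_r_coset_def r_coset_def)
    then have "r \<odot>\<^bsub>M\<^esub> m = j \<odot>\<^bsub>M\<^esub> m \<oplus>\<^bsub>M\<^esub> s \<odot>\<^bsub>M\<^esub> m"
      using s m(1) J.a_Hcarr by (simp add: smult_l_distr)
    moreover have "j \<odot>\<^bsub>M\<^esub> m \<in> D" using radical_submoduleI[OF j(1) m(1)] D(2) by blast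
    ultimately show "r \<odot>\<^bsub>M\<^esub> m \<in> D" using submodule_add[OF D(1)] s(2) by simp
  qed (use r in \<open>auto simp: H_def\<close>)
  have H: "submodule H ?Q (right_regular ?Q)"
  proof (rule Q.submoduleI)
    show "H \<subseteq> carrier (right_regular ?Q)" by (auto simp: H_def Q)
    have "?J +> \<zero> = ?J" using J.a_rcos_const[OF additive_subgroup.zero_closed[OF J.is_additive_subgroup]] by simp
    then show "\<zero>\<^bsub>right_regular ?Q\<^esub> \<in> H"
      using H_iff[of \<zero>] m(1) submodule_zero[OF D(1)] by (simp add: Q)
  next
    fix c d assume "c \<in> H" "d \<in> H"
    then obtain r s where "r \<in> carrier R" "r \<odot>\<^bsub>M\<^esub> m \<in> D" "c = ?J +> r"
      "s \<in> carrier R" "s \<odot>\<^bsub>M\<^esub> m \<in> D" "d = ?J +> s" by (auto simp: H_def)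
    then show "c \<oplus>\<^bsub>right_regular ?Q\<^esub> d \<in> H"
      using submodule_add[OF D(1)] m(1) by (simp add: Q H_iff smult_l_distr)
  next
    fix d c assume "d \<in> carrier ?Q" "c \<in> H"
    then obtain r s where "r \<in> carrier R" "r \<odot>\<^bsub>M\<^esub> m \<in> D" "c = ?J +> r"
      "s \<in> carrier R" "d = ?J +> s" by (auto simp: H_def Q)
    then show "d \<odot>\<^bsub>right_regular ?Q\<^esub> c \<in> H"
      using submodule_smult[OF D(1)] m(1) by (simp add: Q H_iff smult_assoc)
  qed
  \<comment> \<open>Otherwise \<open>H\<close> would be all of \<open>R/J\<close>, but
    \<open>1 + J\<close> is not in \<open>H\<close> because \<open>m\<close> is not in
    \<open>D\<close>.\<close>
  have "\<exists>T. simple_submodule ?Q (right_regular ?Q) T \<and> \<not> T \<subseteq> H"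
  proof (rule ccontr)
    assume "\<not> ?thesis"
    then have "submodule_sum (right_regular ?Q) {T. simple_submodule ?Q (right_regular ?Q) T} \<subseteq> H"
      by (intro Q.submodule_sum_least[OF H]) blast
    then have "carrier ?Q \<subseteq> H"
      using R by (simp add: semilocal_def semisimple_artinian_def semisimple_module_def)
    then have "?J +> \<one> \<in> H" by (auto simp: Q)
    then show False using H_iff[of \<one>] m smult_one by simp
  qed
  then obtain T where T: "simple_submodule ?Q (right_regular ?Q) T" "\<not> T \<subseteq> H" by blast
  then have Ts: "submodule T ?Q (right_regular ?Q)" by (simp add: simple_submodule_def)
  define Y where "Y = (\<lambda>r. r \<odot>\<^bsub>M\<^esub> m) ` {r \<in> carrier R. ?J +> r \<in> T}"
  have Y: "submodule Y R M"
  proof (rule submoduleI)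
    show "Y \<subseteq> carrier M" using m(1) smult_closed by (auto simp: Y_def)
    have "?J +> \<zero> = ?J" using J.a_rcos_const[OF additive_subgroup.zero_closed[OF J.is_additive_subgroup]] by simp
    then have "\<zero> \<odot>\<^bsub>M\<^esub> m \<in> Y"
      using Q.submodule_zero[OF Ts] unfolding Y_def by (intro imageI) (simp add: Q)
    then show "\<zero>\<^bsub>M\<^esub> \<in> Y" using m(1) by simp
  next
    fix x y assume "x \<in> Y" "y \<in> Y"
    then obtain r s where rs: "r \<in> carrier R" "?J +> r \<in> T" "x = r \<odot>\<^bsub>M\<^esub> m"
      "s \<in> carrier R" "?J +> s \<in> T" "y = s \<odot>\<^bsub>M\<^esub> m" by (auto simp: Y_def)
    then have "(r \<oplus> s) \<odot>\<^bsub>M\<^esub> m \<in> Y"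
      using submodule_add[OF Ts, of "?J +> r" "?J +> s"] unfolding Y_def by (intro imageI) (simp add: Q)
    then show "x \<oplus>\<^bsub>M\<^esub> y \<in> Y" using rs m(1) by (simp add: smult_l_distr)
  next
    fix a x assume a: "a \<in> carrier R" and "x \<in> Y"
    then obtain r where r: "r \<in> carrier R" "?J +> r \<in> T" "x = r \<odot>\<^bsub>M\<^esub> m" by (auto simp: Y_def)
    then have "(r \<otimes> a) \<odot>\<^bsub>M\<^esub> m \<in> Y"
      using submodule_smult[OF Ts, of "?J +> a" "?J +> r"] a unfolding Y_def
      by (intro imageI) (simp add: Q)
    then show "a \<odot>\<^bsub>M\<^esub> x \<in> Y" using r a m(1) by (simp add: smult_assoc)
  qed
  note MJ = radical_submodule_submodule
  have "\<not> Y \<subseteq> D"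
  proof
    assume YD: "Y \<subseteq> D"
    have "c \<in> H" if c: "c \<in> T" for c
    proof -
      obtain r where r: "r \<in> carrier R" "c = ?J +> r"
        using submodule_subset[OF Ts] c by (auto simp: Q)
      then have "r \<odot>\<^bsub>M\<^esub> m \<in> Y" using c by (auto simp: Y_def)
      then show ?thesis using r H_iff YD by blast
    qed
    then show False using T(2) by blast
  qed
  \<comment> \<open>The witness \<open>Y + MJ\<close> is the preimage in \<open>M\<close> of the
    image of \<open>T\<close> in \<open>M/MJ\<close>. An element \<open>m r + n\<close> of it that
    lies in \<open>D\<close> has \<open>r + J\<close> in \<open>T \<inter> H = 0\<close>, so
    \<open>r\<close> is in \<open>J\<close>.\<close>
  moreover have "x \<in> ?MJ" if x: "x \<in> Y <+>\<^bsub>M\<^esub> ?MJ" "x \<in> D" for x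
  proof -
    obtain r n where r: "r \<in> carrier R" "?J +> r \<in> T" "n \<in> ?MJ" "x = r \<odot>\<^bsub>M\<^esub> m \<oplus>\<^bsub>M\<^esub> n"
      using x(1) by (auto simp: Y_def set_add_iff)
    have nM: "n \<in> carrier M" using r(3) submodule_carrier[OF MJ] by blast
    have "r \<odot>\<^bsub>M\<^esub> m \<in> D"
      by (rule submodule_add_cancel[OF D(1), of n])
        (use r x(2) D(2) m(1) nM smult_closed in \<open>auto simp: M.a_comm\<close>)
    then have "?J +> r \<in> T \<inter> H" using H_iff r by blast
    then have "?J +> r = ?J"
      using Q.simple_submodule_meet[OF T(1) H T(2)] by (simp add: Q)
    then have "r \<in> ?J" using J.a_rcos_self[OF r(1)] by simp
    then show ?thesis using r(3,4) radical_submoduleI[OF _ m(1)] submodule_add[OF MJ] by blast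
  qed
  moreover have "submodule (Y <+>\<^bsub>M\<^esub> ?MJ) R M" "Y \<subseteq> Y <+>\<^bsub>M\<^esub> ?MJ"
    by (rule set_add_submodule[OF Y MJ] set_add_upper(1)[OF Y MJ])+
  ultimately show ?thesis by blast
qed

lemma semilocal_direct_summand:
  assumes "semilocal R" "submodule A R M" "A \<inter> radical_submodule R M = {\<zero>\<^bsub>M\<^esub>}"
  shows "direct_summand R M A"
  using assms complement_exists[OF assms(2) radical_submodule_submodule] semilocal_not_below
  by (simp add: Int_commute)

end


section \<open>Sums of simple direct summands\<close>

context right_module
begin

lemma simple_summandD:
  assumes "A \<in> {A. simple_submodule R M A \<and> direct_summand R M A}"
  shows "simple_submodule R M A" "direct_summand R M A" "submodule A R M"
  using assms by (auto simp: simple_submodule_def)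

lemma simple_summand_sum_submodule: "submodule (simple_summand_sum R M) R M"
  unfolding simple_summand_sum_def by (rule submodule_sum_submodule, rule simple_summandD)

lemma simple_summand_sum_upper:
  "simple_submodule R M A \<Longrightarrow> direct_summand R M A \<Longrightarrow> A \<subseteq> simple_summand_sum R M"
  unfolding simple_summand_sum_def by (rule submodule_sum_upper) simp

lemma simple_summand_sum_least:
  assumes "submodule H R M" "\<And>A. simple_submodule R M A \<Longrightarrow> direct_summand R M A \<Longrightarrow> A \<subseteq> H"
  shows "simple_summand_sum R M \<subseteq> H"
  unfolding simple_summand_sum_def using assms by (intro submodule_sum_least) auto

text \<open>The elements killed by \<open>J\<close> form a submodule containing all simple summands.
  Closure under scalars uses that \<open>J\<close> is a left ideal:
  \<open>(x r) a = x (r a)\<close>.\<close>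

lemma simple_summand_sum_jacobson:
  assumes a: "a \<in> jacobson_radical R" and x: "x \<in> simple_summand_sum R M"
  shows "a \<odot>\<^bsub>M\<^esub> x = \<zero>\<^bsub>M\<^esub>"
proof -
  interpret J: ideal "jacobson_radical R" R by (rule R.jacobson_radical_ideal)
  let ?H = "{x \<in> carrier M. \<forall>a \<in> jacobson_radical R. a \<odot>\<^bsub>M\<^esub> x = \<zero>\<^bsub>M\<^esub>}"
  have "submodule ?H R M"
  proof (rule submoduleI)
    fix r x assume r: "r \<in> carrier R" and x: "x \<in> ?H"
    have "a \<odot>\<^bsub>M\<^esub> (r \<odot>\<^bsub>M\<^esub> x) = \<zero>\<^bsub>M\<^esub>" if a: "a \<in> jacobson_radical R" for a
      using x J.I_l_closed[OF a r] smult_assoc[of r a x] r a J.a_Hcarr by auto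
    then show "r \<odot>\<^bsub>M\<^esub> x \<in> ?H" using r x smult_closed by simp
  qed (use J.a_Hcarr in \<open>auto simp: smult_r_distr\<close>)
  then have "simple_summand_sum R M \<subseteq> ?H"
    by (rule simple_summand_sum_least)
      (use simple_submodule_jacobson submodule_carrier in \<open>auto simp: simple_submodule_def\<close>)
  then show ?thesis using a x by blast
qed

section \<open>Consequences of simple-direct-injectivity\<close>

lemma simple_summand_radical:
  assumes "simple_submodule R M A" "direct_summand R M A"
  shows "A \<inter> radical_submodule R M = {\<zero>\<^bsub>M\<^esub>}"
  by (rule direct_summand_radical[OF assms(2)]) (rule simple_submodule_jacobson[OF assms(1)])

text \<open>The form in which simple-direct-injectivity is applied: full invariance takes the
  restriction of an endomorphism for \<open>f\<close>, and the argument about \<open>MJ\<close>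
  takes a map sending a generator \<open>a\<close> of \<open>A\<close> to
  \<open>y + a\<close>.\<close>

lemma simple_direct_injective_image:
  assumes sdi: "simple_direct_injective R M" and A: "simple_submodule R M A" "direct_summand R M A"
    and f: "f \<in> mod_hom R (M\<lparr>carrier := A\<rparr>) M" "f ` A \<noteq> {\<zero>\<^bsub>M\<^esub>}"
  shows "simple_submodule R M (f ` A)" "direct_summand R M (f ` A)"
  using sdi simple_submodule_image[OF A(1) f] A unfolding simple_direct_injective_def by blast+

lemma simple_direct_injective_imp_fully_invariant:
  assumes sdi: "simple_direct_injective R M"
  shows "fully_invariant R M (simple_summand_sum R M)"
proof -
  let ?S = "simple_summand_sum R M"
  have "f ` ?S \<subseteq> ?S" if f: "f \<in> mod_hom R M M" for f
  proof -
    \<comment> \<open>The elements sent into \<open>S'\<close> form a submodule, so only simple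
      summands need to be checked.\<close>
    have "submodule {x \<in> carrier M. f x \<in> ?S} R M"
      using mod_hom_preimage[OF carrier_submodule _ simple_summand_sum_submodule, of f] f by simp
    moreover have "A \<subseteq> {x \<in> carrier M. f x \<in> ?S}"
      if A: "simple_submodule R M A" "direct_summand R M A" for A
    proof -
      have sub: "submodule A R M" using A by (simp add: simple_submodule_def)
      note fA = mod_hom_restrict[OF f sub]
      have "f ` A \<subseteq> ?S"
      proof (cases "f ` A = {\<zero>\<^bsub>M\<^esub>}")
        case True
        then show ?thesis using submodule_zero[OF simple_summand_sum_submodule] by simp
      next
        case False
        show ?thesis
          by (rule simple_summand_sum_upper; rule simple_direct_injective_image[OF sdi A fA False])
      qed
      then show ?thesis using submodule_subset[OF sub] by auto
    qed
    ultimately have "?S \<subseteq> {x \<in> carrier M. f x \<in> ?S}" by (rule simple_summand_sum_least)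
    then show ?thesis by blast
  qed
  then show ?thesis
    unfolding fully_invariant_def using simple_summand_sum_submodule by blast
qed

text \<open>\<open>aR\<close> is \<open>R\<close> modulo the annihilator of \<open>a\<close>, so
  \<open>a r \<mapsto> x r\<close> is well defined as soon as that annihilator kills
  \<open>x\<close>.\<close>

lemma cyclic_hom:
  assumes a: "a \<in> carrier M" and x: "x \<in> carrier M"
    and ann: "\<And>r. r \<in> carrier R \<Longrightarrow> r \<odot>\<^bsub>M\<^esub> a = \<zero>\<^bsub>M\<^esub> \<Longrightarrow> r \<odot>\<^bsub>M\<^esub> x = \<zero>\<^bsub>M\<^esub>"
  obtains f where "f \<in> mod_hom R (M\<lparr>carrier := (\<lambda>r. r \<odot>\<^bsub>M\<^esub> a) ` carrier R\<rparr>) M" "f a = x"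
proof -
  define f where "f b = (SOME r. r \<in> carrier R \<and> b = r \<odot>\<^bsub>M\<^esub> a) \<odot>\<^bsub>M\<^esub> x" for b
  have f: "f (r \<odot>\<^bsub>M\<^esub> a) = r \<odot>\<^bsub>M\<^esub> x" if r: "r \<in> carrier R" for r
  proof -
    define s where "s = (SOME s. s \<in> carrier R \<and> r \<odot>\<^bsub>M\<^esub> a = s \<odot>\<^bsub>M\<^esub> a)"
    have "s \<in> carrier R \<and> r \<odot>\<^bsub>M\<^esub> a = s \<odot>\<^bsub>M\<^esub> a"
      unfolding s_def by (rule someI[of _ r]) (use r in simp)
    then have s: "s \<in> carrier R" "r \<odot>\<^bsub>M\<^esub> a = s \<odot>\<^bsub>M\<^esub> a" by auto
    \<comment> \<open>Two coefficients of the same element differ by an annihilator of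
      \<open>a\<close>, hence of \<open>x\<close>; the choice of \<open>s\<close> is
      harmless.\<close>
    then have "(s \<ominus> r) \<odot>\<^bsub>M\<^esub> a = \<zero>\<^bsub>M\<^esub>"
      using r a smult_closed by (simp add: a_minus_def smult_l_distr smult_l_minus M.r_neg)
    then have "(s \<ominus> r) \<odot>\<^bsub>M\<^esub> x = \<zero>\<^bsub>M\<^esub>" using ann r s(1) by simp
    then have "s \<odot>\<^bsub>M\<^esub> x \<oplus>\<^bsub>M\<^esub> \<ominus>\<^bsub>M\<^esub> (r \<odot>\<^bsub>M\<^esub> x) = \<zero>\<^bsub>M\<^esub>"
      using r s(1) x by (simp add: a_minus_def smult_l_distr smult_l_minus)
    then have "s \<odot>\<^bsub>M\<^esub> x = r \<odot>\<^bsub>M\<^esub> x"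
      using r s(1) x smult_closed by (metis M.a_inv_closed M.minus_equality M.minus_minus)
    then show ?thesis by (simp add: f_def s_def)
  qed
  have "f \<in> mod_hom R (M\<lparr>carrier := (\<lambda>r. r \<odot>\<^bsub>M\<^esub> a) ` carrier R\<rparr>) M"
    unfolding mod_hom_def
  proof (intro CollectI conjI ballI)
    show "f \<in> carrier (M\<lparr>carrier := (\<lambda>r. r \<odot>\<^bsub>M\<^esub> a) ` carrier R\<rparr>) \<rightarrow> carrier M"
      using f x smult_closed by auto
  next
    fix b c assume "b \<in> carrier (M\<lparr>carrier := (\<lambda>r. r \<odot>\<^bsub>M\<^esub> a) ` carrier R\<rparr>)"
      "c \<in> carrier (M\<lparr>carrier := (\<lambda>r. r \<odot>\<^bsub>M\<^esub> a) ` carrier R\<rparr>)"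
    then obtain r s where rs: "r \<in> carrier R" "s \<in> carrier R" "b = r \<odot>\<^bsub>M\<^esub> a" "c = s \<odot>\<^bsub>M\<^esub> a" by auto
    then show "f (b \<oplus>\<^bsub>M\<lparr>carrier := (\<lambda>r. r \<odot>\<^bsub>M\<^esub> a) ` carrier R\<rparr>\<^esub> c) = f b \<oplus>\<^bsub>M\<^esub> f c"
      using f[of "r \<oplus> s"] a x by (simp add: smult_l_distr f)
  next
    fix t b assume t: "t \<in> carrier R" and "b \<in> carrier (M\<lparr>carrier := (\<lambda>r. r \<odot>\<^bsub>M\<^esub> a) ` carrier R\<rparr>)"
    then obtain r where r: "r \<in> carrier R" "b = r \<odot>\<^bsub>M\<^esub> a" by auto
    then show "f (t \<odot>\<^bsub>M\<lparr>carrier := (\<lambda>r. r \<odot>\<^bsub>M\<^esub> a) ` carrier R\<rparr>\<^esub> b) = t \<odot>\<^bsub>M\<^esub> f b"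
      using f[of "r \<otimes> t"] t a x by (simp add: smult_assoc f)
  qed
  moreover have "f a = x" using f[of \<one>] a x smult_one by simp
  ultimately show ?thesis using that by blast
qed

text \<open>If \<open>y + a\<close> lies in \<open>MJ\<close>, then \<open>a r = 0\<close> forces \<open>(y + a) r = y r \<in> F \<inter> MJ = 0\<close>, so \<open>(y + a) R\<close>
  is an image of \<open>A\<close>; being a direct summand, it meets \<open>MJ\<close> trivially.\<close>

lemma simple_direct_injective_add_radical:
  assumes sdi: "simple_direct_injective R M"
    and F: "submodule F R M" "F \<inter> radical_submodule R M = {\<zero>\<^bsub>M\<^esub>}"
    and A: "simple_submodule R M A" "direct_summand R M A"
  shows "(F <+>\<^bsub>M\<^esub> A) \<inter> radical_submodule R M = {\<zero>\<^bsub>M\<^esub>}"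
proof -
  let ?MJ = "radical_submodule R M"
  note MJ = radical_submodule_submodule
  have sub: "submodule A R M" using A by (simp add: simple_submodule_def)
  have "x = \<zero>\<^bsub>M\<^esub>" if x: "x \<in> F <+>\<^bsub>M\<^esub> A" "x \<in> ?MJ" for x
  proof (rule ccontr)
    assume nz: "x \<noteq> \<zero>\<^bsub>M\<^esub>"
    obtain y a where ya: "y \<in> F" "a \<in> A" "x = y \<oplus>\<^bsub>M\<^esub> a" using x(1) by (auto simp: set_add_iff)
    have yM: "y \<in> carrier M" and aM: "a \<in> carrier M" and xM: "x \<in> carrier M"
      using ya submodule_carrier[OF F(1)] submodule_carrier[OF sub] by auto
    have "a \<noteq> \<zero>\<^bsub>M\<^esub>"
    proof
      assume "a = \<zero>\<^bsub>M\<^esub>"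
      then have "x \<in> F" using ya yM by simp
      then show False using nz x(2) F(2) by blast
    qed
    then have cyc: "(\<lambda>r. r \<odot>\<^bsub>M\<^esub> a) ` carrier R = A"
      using simple_submodule_cyclic[OF A(1) ya(2)] by simp
    have ann: "r \<odot>\<^bsub>M\<^esub> x = \<zero>\<^bsub>M\<^esub>" if r: "r \<in> carrier R" "r \<odot>\<^bsub>M\<^esub> a = \<zero>\<^bsub>M\<^esub>" for r
    proof -
      have "r \<odot>\<^bsub>M\<^esub> x = r \<odot>\<^bsub>M\<^esub> y"
        using r ya(3) yM aM smult_closed by (simp add: smult_r_distr)
      then have "r \<odot>\<^bsub>M\<^esub> x \<in> F" using submodule_smult[OF F(1) r(1) ya(1)] by simp
      then show ?thesis using F(2) submodule_smult[OF MJ r(1) x(2)] by blast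
    qed
    obtain f where f: "f \<in> mod_hom R (M\<lparr>carrier := A\<rparr>) M" "f a = x"
      using cyclic_hom[OF aM xM ann] unfolding cyc by blast
    have xf: "x \<in> f ` A" using f(2) ya(2) by blast
    then have "f ` A \<noteq> {\<zero>\<^bsub>M\<^esub>}" using nz by blast
    from simple_summand_radical[OF simple_direct_injective_image[OF sdi A f(1) this]]
    show False using xf x(2) nz by blast
  qed
  then show ?thesis
    using submodule_zero[OF MJ] submodule_zero[OF set_add_submodule[OF F(1) sub]] by blast
qed

text \<open>Each element of \<open>S'\<close> is reached by adding finitely many simple summands,
  and each addition keeps the intersection with \<open>MJ\<close> trivial.\<close>

lemma simple_direct_injective_imp_radical:
  assumes sdi: "simple_direct_injective R M"
  shows "simple_summand_sum R M \<inter> radical_submodule R M = {\<zero>\<^bsub>M\<^esub>}"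
proof -
  let ?MJ = "radical_submodule R M"
  let ?F = "{A. simple_submodule R M A \<and> direct_summand R M A}"
  note MJ = radical_submodule_submodule
  define good where "good F \<longleftrightarrow> submodule F R M \<and> F \<inter> ?MJ = {\<zero>\<^bsub>M\<^esub>}" for F
  have step: "\<exists>F'. good F' \<and> F \<subseteq> F' \<and> A \<subseteq> F'" if "good F" "A \<in> ?F" for F A
  proof (intro exI conjI)
    have F: "submodule F R M" "F \<inter> ?MJ = {\<zero>\<^bsub>M\<^esub>}" using that(1) by (auto simp: good_def)
    note A = simple_summandD[OF that(2)]
    show "good (F <+>\<^bsub>M\<^esub> A)"
      unfolding good_def
      using set_add_submodule[OF F(1) A(3)] simple_direct_injective_add_radical[OF sdi F A(1,2)] by blast
    show "F \<subseteq> F <+>\<^bsub>M\<^esub> A" "A \<subseteq> F <+>\<^bsub>M\<^esub> A" by (rule set_add_upper[OF F(1) A(3)])+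
  qed
  have zero: "good {\<zero>\<^bsub>M\<^esub>}"
    using zero_submodule submodule_zero[OF MJ] by (simp add: good_def)
  \<comment> \<open>The claim covers every good \<open>F\<close>, not just 0: for a sum
    \<open>h1 + h2\<close> the second enlargement starts from the submodule reached by the
    first.\<close>
  have "\<forall>F. good F \<longrightarrow> (\<exists>F'. good F' \<and> F \<subseteq> F' \<and> s \<in> F')"
    if "s \<in> generate (add_monoid M) (\<Union>?F)" for s
    using that
  proof induction
    case one
    have "\<zero>\<^bsub>M\<^esub> \<in> F" if "good F" for F
      using that submodule_zero by (auto simp: good_def)
    then show ?case by auto
  next
    case (incl h)
    then obtain A where "A \<in> ?F" "h \<in> A" by blast
    then show ?case using step by blast
  next
    case (inv h)
    then obtain A where A: "A \<in> ?F" "h \<in> A" by blast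
    then have "inv\<^bsub>add_monoid M\<^esub> h \<in> A"
      using submodule_minus[OF simple_summandD(3)[OF A(1)] A(2)] by (simp add: a_inv_def)
    then show ?case using step A(1) by blast
  next
    case (eng h1 h2)
    show ?case
    proof (intro allI impI)
      fix F assume "good F"
      then obtain F' where F': "good F'" "F \<subseteq> F'" "h1 \<in> F'" using eng.IH(1) by blast
      then obtain F'' where F'': "good F''" "F' \<subseteq> F''" "h2 \<in> F''" using eng.IH(2) by blast
      then have sF: "submodule F'' R M" by (simp add: good_def)
      have "h1 \<oplus>\<^bsub>M\<^esub> h2 \<in> F''" by (rule submodule_add[OF sF]) (use F' F'' in auto)
      then show "\<exists>F'. good F' \<and> F \<subseteq> F' \<and> h1 \<otimes>\<^bsub>add_monoid M\<^esub> h2 \<in> F'"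
        using F' F'' by (intro exI[of _ F'']) auto
    qed
  qed
  then have "s = \<zero>\<^bsub>M\<^esub>" if "s \<in> simple_summand_sum R M" "s \<in> ?MJ" for s
    using that zero unfolding simple_summand_sum_def submodule_sum_def good_def by blast
  then show ?thesis
    using submodule_zero[OF MJ] submodule_zero[OF simple_summand_sum_submodule] by blast
qed

section \<open>Projections, and the way back to simple-direct-injectivity\<close>

lemma internal_direct_sum_projection:
  assumes "internal_direct_sum R M A N"
  obtains p where "p \<in> mod_hom R M M" "\<And>a. a \<in> A \<Longrightarrow> p a = a" "\<And>x. x \<in> carrier M \<Longrightarrow> p x \<in> A"
proof -
  have A: "submodule A R M" and N: "submodule N R M" and sum: "A <+>\<^bsub>M\<^esub> N = carrier M"
    and int: "A \<inter> N = {\<zero>\<^bsub>M\<^esub>}"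
    using assms by (auto simp: internal_direct_sum_def)
  have AM: "a \<in> carrier M" if "a \<in> A" for a using that submodule_carrier[OF A] by blast
  have NM: "a \<in> carrier M" if "a \<in> N" for a using that submodule_carrier[OF N] by blast
  define p where "p x = (SOME a. a \<in> A \<and> (\<exists>n\<in>N. x = a \<oplus>\<^bsub>M\<^esub> n))" for x
  have p: "p (a \<oplus>\<^bsub>M\<^esub> n) = a" if an: "a \<in> A" "n \<in> N" for a n
  proof -
    have "p (a \<oplus>\<^bsub>M\<^esub> n) \<in> A \<and> (\<exists>n'\<in>N. a \<oplus>\<^bsub>M\<^esub> n = p (a \<oplus>\<^bsub>M\<^esub> n) \<oplus>\<^bsub>M\<^esub> n')"
      unfolding p_def by (rule someI[of _ a]) (use an in blast)
    then obtain b n' where b: "b = p (a \<oplus>\<^bsub>M\<^esub> n)" "b \<in> A" "n' \<in> N" "a \<oplus>\<^bsub>M\<^esub> n = b \<oplus>\<^bsub>M\<^esub> n'" by blast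
    have M: "a \<in> carrier M" "n \<in> carrier M" "b \<in> carrier M" "n' \<in> carrier M"
      using an b(2,3) AM NM by auto
    \<comment> \<open>The difference of two \<open>A\<close>-components equals a difference of
      \<open>N\<close>-components, so it lies in \<open>A \<inter> N = 0\<close>.\<close>
    have "n \<oplus>\<^bsub>M\<^esub> (\<ominus>\<^bsub>M\<^esub> b \<oplus>\<^bsub>M\<^esub> a) = \<ominus>\<^bsub>M\<^esub> b \<oplus>\<^bsub>M\<^esub> (a \<oplus>\<^bsub>M\<^esub> n)"
      using M by (simp add: M.a_ac)
    also have "\<dots> = n'" unfolding b(4) using M by (simp add: M.r_neg1)
    finally have eq: "n \<oplus>\<^bsub>M\<^esub> (\<ominus>\<^bsub>M\<^esub> b \<oplus>\<^bsub>M\<^esub> a) = n'" .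
    have "\<ominus>\<^bsub>M\<^esub> b \<oplus>\<^bsub>M\<^esub> a \<in> N"
      by (rule submodule_add_cancel[OF N, of n]) (use eq an(2) b(3) M in simp_all)
    moreover have "\<ominus>\<^bsub>M\<^esub> b \<oplus>\<^bsub>M\<^esub> a \<in> A"
      by (intro submodule_add[OF A] submodule_minus[OF A] an(1) b(2))
    ultimately have "\<ominus>\<^bsub>M\<^esub> b \<oplus>\<^bsub>M\<^esub> a = \<zero>\<^bsub>M\<^esub>" using int by blast
    then have "a = b" using M.minus_equality[of "\<ominus>\<^bsub>M\<^esub> b" a] M by (metis M.a_inv_closed M.minus_minus)
    then show ?thesis using b(1) by simp
  qed
  have split: "\<exists>a\<in>A. \<exists>n\<in>N. x = a \<oplus>\<^bsub>M\<^esub> n" if "x \<in> carrier M" for x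
    using that sum set_add_iff by blast
  have pa: "p a = a" if "a \<in> A" for a
    using p[OF that submodule_zero[OF N]] AM[OF that] by simp
  have pA: "p x \<in> A" if "x \<in> carrier M" for x
    using split[OF that] p by auto
  have "p \<in> mod_hom R M M"
    unfolding mod_hom_def
  proof (intro CollectI conjI ballI)
    show "p \<in> carrier M \<rightarrow> carrier M" using pA AM by blast
  next
    fix x y assume "x \<in> carrier M" "y \<in> carrier M"
    then obtain a n b k where *: "a \<in> A" "n \<in> N" "x = a \<oplus>\<^bsub>M\<^esub> n" "b \<in> A" "k \<in> N" "y = b \<oplus>\<^bsub>M\<^esub> k"
      using split by meson
    then have "x \<oplus>\<^bsub>M\<^esub> y = (a \<oplus>\<^bsub>M\<^esub> b) \<oplus>\<^bsub>M\<^esub> (n \<oplus>\<^bsub>M\<^esub> k)"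
      using AM NM by (simp add: M.a_ac)
    then show "p (x \<oplus>\<^bsub>M\<^esub> y) = p x \<oplus>\<^bsub>M\<^esub> p y"
      using * p submodule_add[OF A] submodule_add[OF N] by simp
  next
    fix r x assume r: "r \<in> carrier R" and "x \<in> carrier M"
    then obtain a n where *: "a \<in> A" "n \<in> N" "x = a \<oplus>\<^bsub>M\<^esub> n" using split by meson
    then have "r \<odot>\<^bsub>M\<^esub> x = r \<odot>\<^bsub>M\<^esub> a \<oplus>\<^bsub>M\<^esub> r \<odot>\<^bsub>M\<^esub> n"
      using r AM NM by (simp add: smult_r_distr)
    then show "p (r \<odot>\<^bsub>M\<^esub> x) = r \<odot>\<^bsub>M\<^esub> p x"
      using * r p submodule_smult[OF A] submodule_smult[OF N] by simp
  qed
  then show ?thesis using that pa pA by blast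
qed

text \<open>\<open>M/N\<close> is a copy of \<open>S'\<close>, a sum of simple modules. So
  \<open>complement_exists\<close> applies over \<open>N\<close>: a proper \<open>D\<close> above
  \<open>N\<close> omits some simple summand, which then meets \<open>D\<close> in 0.\<close>

lemma summand_of_simple_summand_sum:
  assumes N: "internal_direct_sum R M (simple_summand_sum R M) N"
    and A: "submodule A R M" "A \<subseteq> simple_summand_sum R M"
  shows "direct_summand R M A"
proof -
  let ?S = "simple_summand_sum R M"
  have sub: "submodule N R M" and sum: "?S <+>\<^bsub>M\<^esub> N = carrier M" and int: "?S \<inter> N = {\<zero>\<^bsub>M\<^esub>}"
    using N by (auto simp: internal_direct_sum_def)
  show ?thesis
  proof (rule complement_exists[OF A(1) sub])
    show "N \<inter> A = {\<zero>\<^bsub>M\<^esub>}"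
      using int A(2) submodule_zero[OF A(1)] by blast
    fix D assume D: "submodule D R M" "N \<subseteq> D" "D \<noteq> carrier M"
    have "\<not> ?S \<subseteq> D"
    proof
      assume "?S \<subseteq> D"
      then have "carrier M \<subseteq> D" using set_add_least[OF D(1) _ D(2), of ?S] sum by simp
      then show False using D(3) submodule_subset[OF D(1)] by blast
    qed
    then obtain B where B: "simple_submodule R M B" "\<not> B \<subseteq> D"
      using simple_summand_sum_least[OF D(1)] by blast
    then show "\<exists>X. submodule X R M \<and> \<not> X \<subseteq> D \<and> X \<inter> D \<subseteq> N"
      using simple_submodule_meet[OF B(1) D(1) B(2)] submodule_zero[OF sub]
      by (intro exI[of _ B]) (simp add: simple_submodule_def)
  qed
qed

lemma fully_invariant_summand_imp_simple_direct_injective: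
  assumes N: "internal_direct_sum R M (simple_summand_sum R M) N"
    and inv: "fully_invariant R M (simple_summand_sum R M)"
  shows "simple_direct_injective R M"
  unfolding simple_direct_injective_def
proof (intro allI impI; elim conjE)
  let ?S = "simple_summand_sum R M"
  fix A B
  assume A: "simple_submodule R M A" and B: "simple_submodule R M B" "direct_summand R M B"
    and iso: "mod_isomorphic R (M\<lparr>carrier := A\<rparr>) (M\<lparr>carrier := B\<rparr>)"
  have sA: "submodule A R M" and sB: "submodule B R M"
    using A B by (simp_all add: simple_submodule_def)
  obtain g where g: "g \<in> mod_hom R (M\<lparr>carrier := A\<rparr>) (M\<lparr>carrier := B\<rparr>)" and "bij_betw g A B"
    using iso by (auto simp: mod_isomorphic_def)
  then have inj: "inj_on g A" and gA: "g ` A = B" by (auto simp: bij_betw_def)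
  have g_add: "g (a \<oplus>\<^bsub>M\<^esub> b) = g a \<oplus>\<^bsub>M\<^esub> g b" if "a \<in> A" "b \<in> A" for a b
    using g that by (simp add: mod_hom_def)
  have g_smult: "g (r \<odot>\<^bsub>M\<^esub> a) = r \<odot>\<^bsub>M\<^esub> g a" if "r \<in> carrier R" "a \<in> A" for r a
    using g that by (simp add: mod_hom_def)
  obtain C where "internal_direct_sum R M B C" using B(2) by (auto simp: direct_summand_def)
  then obtain p where p: "p \<in> mod_hom R M M" "\<And>b. b \<in> B \<Longrightarrow> p b = b" "\<And>x. x \<in> carrier M \<Longrightarrow> p x \<in> B"
    using internal_direct_sum_projection by blast
  \<comment> \<open>Projection onto \<open>B\<close> followed by the inverse of \<open>g\<close>: an
    endomorphism of \<open>M\<close> that carries \<open>B\<close> onto \<open>A\<close>.\<close>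
  define f where "f x = inv_into A g (p x)" for x
  have fA: "f x \<in> A" "g (f x) = p x" if "x \<in> carrier M" for x
    using p(3)[OF that] gA by (auto simp: f_def inv_into_into f_inv_into_f)
  \<comment> \<open>As \<open>g\<close> is injective, \<open>f x\<close> is determined by
    \<open>g (f x) = p x\<close>; linearity of \<open>f\<close> then follows from that of
    \<open>g\<close> and \<open>p\<close>.\<close>
  have f_eq: "f x = a" if "x \<in> carrier M" "a \<in> A" "p x = g a" for x a
    using that inj by (simp add: f_def)
  have "f \<in> mod_hom R M M"
    unfolding mod_hom_def
  proof (intro CollectI conjI ballI)
    show "f \<in> carrier M \<rightarrow> carrier M" using fA submodule_carrier[OF sA] by blast
  next
    fix x y assume "x \<in> carrier M" "y \<in> carrier M"
    then show "f (x \<oplus>\<^bsub>M\<^esub> y) = f x \<oplus>\<^bsub>M\<^esub> f y"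
      using p(1) fA submodule_add[OF sA] by (intro f_eq) (auto simp: g_add mod_hom_def)
  next
    fix r x assume "r \<in> carrier R" "x \<in> carrier M"
    then show "f (r \<odot>\<^bsub>M\<^esub> x) = r \<odot>\<^bsub>M\<^esub> f x"
      using p(1) fA submodule_smult[OF sA] smult_closed by (intro f_eq) (auto simp: g_smult mod_hom_def)
  qed
  then have "f ` ?S \<subseteq> ?S" using inv by (simp add: fully_invariant_def)
  moreover have "a \<in> f ` ?S" if a: "a \<in> A" for a
  proof -
    have ga: "g a \<in> B" using gA a by blast
    then have "f (g a) = a" using f_eq[of "g a" a] p(2) a submodule_carrier[OF sB] by simp
    then show ?thesis using ga simple_summand_sum_upper[OF B] by (metis imageI subsetD)
  qed
  ultimately have "A \<subseteq> ?S" by blast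
  then show "direct_summand R M A" by (rule summand_of_simple_summand_sum[OF N sA])
qed


section \<open>Purity\<close>

lemma right_module_submodule:
  assumes "submodule A R M"
  shows "right_module R (M\<lparr>carrier := A\<rparr>)"
proof -
  have AM: "x \<in> carrier M" if "x \<in> A" for x
    using submodule_carrier[OF assms that] .
  have "abelian_group (M\<lparr>carrier := A\<rparr>)"
  proof (rule abelian_groupI)
    fix x assume "x \<in> carrier (M\<lparr>carrier := A\<rparr>)"
    then show "\<exists>y \<in> carrier (M\<lparr>carrier := A\<rparr>). y \<oplus>\<^bsub>M\<lparr>carrier := A\<rparr>\<^esub> x = \<zero>\<^bsub>M\<lparr>carrier := A\<rparr>\<^esub>"
      using submodule_minus[OF assms] AM by (intro bexI[of _ "\<ominus>\<^bsub>M\<^esub> x"]) (simp_all add: M.l_neg)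
  qed (simp_all add: submodule_add[OF assms] submodule_zero[OF assms] AM M.a_ac)
  then show ?thesis
    unfolding right_module_def right_module_axioms_def
    using R.ring_axioms
    by (simp add: AM submodule_smult[OF assms] smult_l_distr smult_r_distr smult_assoc smult_one)
qed

section \<open>Relations of the tensor product and the two directions for purity\<close>

lemma tensor_relators_carrier:
  assumes "left_module R L"
  shows "tensor_relators R M L \<subseteq> carrier (tensor_free M L)"
  by (rule tensor_relators_subset) (auto simp: smult_closed assms)

lemma tensor_null_closed:
  assumes L: "left_module R L"
  shows "0 \<in> tensor_null R M L"
    and "p \<in> tensor_null R M L \<Longrightarrow> q \<in> tensor_null R M L \<Longrightarrow> p + q \<in> tensor_null R M L"
    and "p \<in> tensor_null R M L \<Longrightarrow> - p \<in> tensor_null R M L"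
proof -
  have sub: "subgroup (tensor_null R M L) (tensor_free M L)"
    by (rule tensor_null_subgroup) (auto simp: smult_closed L)
  show "0 \<in> tensor_null R M L" using subgroup.one_closed[OF sub] by simp
  show "p + q \<in> tensor_null R M L" if "p \<in> tensor_null R M L" "q \<in> tensor_null R M L"
    using subgroup.m_closed[OF sub that] by simp
  show "- p \<in> tensor_null R M L" if p: "p \<in> tensor_null R M L"
    using subgroup.m_inv_closed[OF sub p] keys_subset_if_carrier[OF p subgroup.subset[OF sub]] by simp
qed

lemma tensor_relators_null: "q \<in> tensor_relators R M L \<Longrightarrow> q \<in> tensor_null R M L"
  unfolding tensor_null_def by (rule generate.incl)

text \<open>The universal property of the tensor product, read in the free group before passing to
  cosets. \<open>K\<close> is the relation subgroup of another tensor product or the zero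
  group.\<close>

lemma tensor_null_hom:
  assumes L: "left_module R L" and G: "group G" and h: "h \<in> hom (tensor_free M L) G"
    and K: "subgroup K G" and rel: "h ` tensor_relators R M L \<subseteq> K" and p: "p \<in> tensor_null R M L"
  shows "h p \<in> K"
proof -
  interpret h: group_hom "tensor_free M L" G h
    using G h by (simp add: group_hom_def group_hom_axioms_def)
  have "h ` tensor_null R M L = generate G (h ` tensor_relators R M L)"
    unfolding tensor_null_def by (rule h.generate_img[symmetric, OF tensor_relators_carrier[OF L]])
  also have "\<dots> \<subseteq> K" by (rule group.generate_subgroup_incl[OF G rel K])
  finally show ?thesis using p by blast
qed

text \<open>The projection onto \<open>A\<close> induces a retraction of
  \<open>M \<otimes> L\<close> onto \<open>A \<otimes> L\<close>, so no relation is lost on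
  \<open>A\<close>.\<close>

lemma direct_summand_pure:
  assumes "internal_direct_sum R M A N"
  shows "pure_submodule R M A"
proof -
  have A: "submodule A R M" using assms by (simp add: internal_direct_sum_def)
  let ?A = "M\<lparr>carrier := A\<rparr>"
  interpret A: right_module R ?A by (rule right_module_submodule[OF A])
  obtain p where p: "p \<in> mod_hom R M M" "\<And>a. a \<in> A \<Longrightarrow> p a = a" "\<And>x. x \<in> carrier M \<Longrightarrow> p x \<in> A"
    using internal_direct_sum_projection[OF assms] by blast
  have p_add: "p (x \<oplus>\<^bsub>M\<^esub> y) = p x \<oplus>\<^bsub>M\<^esub> p y" if "x \<in> carrier M" "y \<in> carrier M" for x y
    using p(1) that by (simp add: mod_hom_def)
  have p_smult: "p (r \<odot>\<^bsub>M\<^esub> x) = r \<odot>\<^bsub>M\<^esub> p x" if "r \<in> carrier R" "x \<in> carrier M" for r x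
    using p(1) that by (simp add: mod_hom_def)
  have "q \<in> tensor_null R ?A L"
    if L: "left_module R L" and keys: "Poly_Mapping.keys q \<subseteq> A \<times> carrier L"
      and q: "q \<in> tensor_null R M L" for L :: "('a, 'a list) module" and q
  proof -
    let ?e = "frag_extend (\<lambda>(x, l). frag_of (p x, l))"
    have e: "?e \<in> hom (tensor_free M L) (tensor_free ?A L)"
    proof (rule homI)
      fix u assume "u \<in> carrier (tensor_free M L)"
      then have u: "Poly_Mapping.keys u \<subseteq> carrier M \<times> carrier L" by simp
      have "Poly_Mapping.keys (?e u) \<subseteq> A \<times> carrier L"
      proof (rule order_trans[OF keys_frag_extend], rule UN_least)
        fix z assume "z \<in> Poly_Mapping.keys u"
        then have "z \<in> carrier M \<times> carrier L" using u by blast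
        then show "Poly_Mapping.keys (case z of (x, l) \<Rightarrow> frag_of (p x, l)) \<subseteq> A \<times> carrier L"
          using p(3) by (auto simp: keys_frag_of)
      qed
      then show "?e u \<in> carrier (tensor_free ?A L)" by simp
    qed (simp add: frag_extend_add)
    have "?e r \<in> tensor_relators R ?A L" if "r \<in> tensor_relators R M L" for r
      using that
    proof (cases rule: tensor_relatorsE)
      case (1 x y l)
      then show ?thesis
        using tensor_relatorsI(1)[of "p x" ?A "p y" l L R] p(3)
        by (simp add: frag_extend_diff p_add)
    next
      case (2 x k l)
      then show ?thesis
        using tensor_relatorsI(2)[of "p x" ?A k L l R] p(3) by (simp add: frag_extend_diff)
    next
      case (3 a x l)
      then show ?thesis
        using tensor_relatorsI(3)[of a R "p x" ?A l L] p(3) by (simp add: frag_extend_diff p_smult)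
    qed
    then have rel: "?e ` tensor_relators R M L \<subseteq> tensor_null R ?A L"
      using A.tensor_relators_null by blast
    have "subgroup (tensor_null R ?A L) (tensor_free ?A L)"
      by (rule tensor_null_subgroup[OF _ _ L]) (auto simp: submodule_add[OF A] submodule_smult[OF A])
    then have "?e q \<in> tensor_null R ?A L"
      by (rule tensor_null_hom[OF L group_free_Abelian_group e _ rel q])
    \<comment> \<open>Only first components in \<open>A\<close> occur in \<open>q\<close>, and
      \<open>p\<close> fixes them.\<close>
    moreover have "?e q = frag_extend frag_of q"
      by (rule frag_extend_eq) (use keys p(2) in auto)
    ultimately show ?thesis using frag_expansion[of q] by simp
  qed
  then show ?thesis
    unfolding pure_submodule_def pure_submodule_wrt_def
    by (simp add: A tensor_inclusion_mon_iff[OF A right_module_axioms])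
qed

text \<open>Purity is tested on \<open>L = R / J\<close>: for \<open>x \<in> MJ\<close> the tensor \<open>x \<otimes> 1\<close> vanishes in \<open>M \<otimes> R / J\<close>, while
  \<open>x \<otimes> (r + J) \<mapsto> x r\<close> is well defined on \<open>A \<otimes> R / J\<close> because \<open>AJ = 0\<close>.\<close>

lemma pure_submodule_radical:
  assumes pure: "pure_submodule R M A"
    and null: "\<And>a x. a \<in> jacobson_radical R \<Longrightarrow> x \<in> A \<Longrightarrow> a \<odot>\<^bsub>M\<^esub> x = \<zero>\<^bsub>M\<^esub>"
  shows "A \<inter> radical_submodule R M = {\<zero>\<^bsub>M\<^esub>}"
proof -
  let ?J = "jacobson_radical R"
  let ?Q = "R Quot ?J"
  let ?A = "M\<lparr>carrier := A\<rparr>"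
  interpret J: ideal ?J R by (rule R.jacobson_radical_ideal)
  interpret Q: ring ?Q by (rule J.quotient_is_ring)
  have Q: "carrier ?Q = (+>) ?J ` carrier R" "\<zero>\<^bsub>?Q\<^esub> = ?J" "\<one>\<^bsub>?Q\<^esub> = ?J +> \<one>"
    "\<And>r s. r \<in> carrier R \<Longrightarrow> s \<in> carrier R \<Longrightarrow> (?J +> r) \<oplus>\<^bsub>?Q\<^esub> (?J +> s) = ?J +> (r \<oplus> s)"
    "\<And>r s. r \<in> carrier R \<Longrightarrow> s \<in> carrier R \<Longrightarrow> (?J +> r) \<otimes>\<^bsub>?Q\<^esub> (?J +> s) = ?J +> (r \<otimes> s)"
    by (auto simp: FactRing_simps J.a_rcos_sum J.rcoset_mult_add)
  have QI: "?J +> r \<in> carrier ?Q" if "r \<in> carrier R" for r using that by (simp add: Q)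
  have A: "submodule A R M"
    using pure by (simp add: pure_submodule_def pure_submodule_wrt_def)
  interpret A: right_module R ?A by (rule right_module_submodule[OF A])
  have AM: "x \<in> carrier M" if "x \<in> A" for x using submodule_carrier[OF A that] .
  \<comment> \<open>\<open>R/J\<close> as a left module over \<open>R\<close> itself, with scalars
    acting through their cosets.\<close>
  define L :: "('a, 'a set) module" where
    "L = \<lparr>carrier = carrier ?Q, mult = undefined, one = undefined, ring.zero = \<zero>\<^bsub>?Q\<^esub>,
      ring.add = add ?Q, smult = (\<lambda>a X. (?J +> a) \<otimes>\<^bsub>?Q\<^esub> X)\<rparr>"
  have L_simps [simp]: "carrier L = carrier ?Q" "\<zero>\<^bsub>L\<^esub> = \<zero>\<^bsub>?Q\<^esub>" "X \<oplus>\<^bsub>L\<^esub> Y = X \<oplus>\<^bsub>?Q\<^esub> Y"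
    "a \<odot>\<^bsub>L\<^esub> X = (?J +> a) \<otimes>\<^bsub>?Q\<^esub> X" for X Y a
    by (simp_all add: L_def)
  have L: "left_module R L"
  proof -
    have "abelian_group L"
    proof (rule abelian_groupI)
      fix x assume "x \<in> carrier L"
      then show "\<exists>y \<in> carrier L. y \<oplus>\<^bsub>L\<^esub> x = \<zero>\<^bsub>L\<^esub>"
        by (intro bexI[of _ "\<ominus>\<^bsub>?Q\<^esub> x"]) (simp_all add: Q.l_neg)
    qed (simp_all add: Q.a_ac)
    then show ?thesis
      unfolding left_module_def left_module_axioms_def
      using R.ring_axioms
      by (simp add: QI Q(4,5)[symmetric] Q(3)[symmetric] Q.l_distr Q.r_distr Q.m_assoc)
  qed
  have MJ: "frag_of (x, l) \<in> tensor_null R M L" if x: "x \<in> radical_submodule R M" and l: "l \<in> carrier L" for x l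
  proof -
    \<comment> \<open>All \<open>l\<close> are taken at once because moving a scalar across the
      tensor replaces \<open>l\<close> by a multiple.\<close>
    let ?H = "{x \<in> carrier M. \<forall>l \<in> carrier L. frag_of (x, l) \<in> tensor_null R M L}"
    note closed = tensor_null_closed[OF L]
    have add: "frag_of (x \<oplus>\<^bsub>M\<^esub> y, l) \<in> tensor_null R M L"
      if "x \<in> carrier M" "y \<in> carrier M" "l \<in> carrier L"
        "frag_of (x, l) \<in> tensor_null R M L" "frag_of (y, l) \<in> tensor_null R M L" for x y l
      using closed(2)[OF closed(2)[OF tensor_relators_null[OF tensor_relatorsI(1)[OF that(1-3)]] that(4)] that(5)]
      by simp
    have smult: "frag_of (a \<odot>\<^bsub>M\<^esub> x, l) \<in> tensor_null R M L"
      if "a \<in> carrier R" "x \<in> carrier M" "l \<in> carrier L"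
        "frag_of (x, a \<odot>\<^bsub>L\<^esub> l) \<in> tensor_null R M L" for a x l
      using closed(2)[OF tensor_relators_null[OF tensor_relatorsI(3)[OF that(1-3)]] that(4)] by simp
    \<comment> \<open>With both summands 0, the additivity relator collapses to the negative of the
      wanted generator.\<close>
    have zero_l: "frag_of (\<zero>\<^bsub>M\<^esub>, l) \<in> tensor_null R M L" if "l \<in> carrier L" for l
      using closed(3)[OF tensor_relators_null[OF tensor_relatorsI(1)[of "\<zero>\<^bsub>M\<^esub>" M "\<zero>\<^bsub>M\<^esub>" l L R]]] that
      by simp
    have zero_r: "frag_of (x, \<zero>\<^bsub>L\<^esub>) \<in> tensor_null R M L" if "x \<in> carrier M" for x
      using closed(3)[OF tensor_relators_null[OF tensor_relatorsI(2)[of x M "\<zero>\<^bsub>L\<^esub>" L "\<zero>\<^bsub>L\<^esub>" R]]] that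
      by simp
    have H: "submodule ?H R M"
      by (rule submoduleI) (use add smult zero_l smult_closed QI in auto)
    have gen: "a \<odot>\<^bsub>M\<^esub> y \<in> ?H" if a: "a \<in> ?J" and y: "y \<in> carrier M" for a y
    proof -
      have aR: "a \<in> carrier R" using J.a_Hcarr[OF a] .
      \<comment> \<open>Elements of \<open>J\<close> act as zero on \<open>R/J\<close>, so a
        generator \<open>y a\<close> of \<open>MJ\<close> gives
        \<open>y a \<otimes> k = y \<otimes> a k = y \<otimes> 0\<close>.\<close>
      have "a \<odot>\<^bsub>L\<^esub> k = \<zero>\<^bsub>L\<^esub>" if "k \<in> carrier L" for k
      proof -
        have "?J +> a = \<zero>\<^bsub>?Q\<^esub>" using J.a_rcos_const[OF a] by (simp only: Q(2))
        then show ?thesis using that by simp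
      qed
      then show ?thesis using smult[OF aR y] zero_r[OF y] aR y smult_closed by simp
    qed
    have "radical_submodule R M \<subseteq> ?H"
      unfolding radical_submodule_def by (rule generate_least[OF H]) (use gen in blast)
    then show ?thesis using x l by blast
  qed
  \<comment> \<open>An arbitrary representative of the coset is chosen; another one differs by an
    element of \<open>J\<close>, which kills \<open>x\<close>.\<close>
  define f where "f = (\<lambda>(x, X). (SOME r. r \<in> X) \<odot>\<^bsub>M\<^esub> x)"
  have f: "f (x, ?J +> r) = r \<odot>\<^bsub>M\<^esub> x" if x: "x \<in> A" and r: "r \<in> carrier R" for x r
  proof -
    have "(SOME s. s \<in> ?J +> r) \<in> ?J +> r" using J.a_rcos_self[OF r] by (rule someI)
    then obtain j where j: "j \<in> ?J" "(SOME s. s \<in> ?J +> r) = j \<oplus> r"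
      by (auto simp: a_r_coset_def r_coset_def)
    then show ?thesis
      using null[OF j(1) x] AM[OF x] J.a_Hcarr[OF j(1)] r smult_closed by (simp add: f_def smult_l_distr)
  qed
  have fM: "f ` (A \<times> carrier L) \<subseteq> carrier M" using f AM smult_closed by (auto simp: Q)
  obtain h where h: "h \<in> hom (free_Abelian_group (A \<times> carrier L)) (add_monoid M)"
    "\<And>z. z \<in> A \<times> carrier L \<Longrightarrow> h (frag_of z) = f z"
    using comm_group.free_Abelian_group_universal[OF M.a_comm_group, of f "A \<times> carrier L"] fM by auto
  have kd: "Poly_Mapping.keys (u - v) \<subseteq> A \<times> carrier L"
    if "Poly_Mapping.keys u \<subseteq> A \<times> carrier L" "Poly_Mapping.keys v \<subseteq> A \<times> carrier L"
    for u v :: "'c \<times> 'a set \<Rightarrow>\<^sub>0 int"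
    using keys_diff[of u v] that by blast
  \<comment> \<open>\<open>h\<close> is additive only on elements supported in
    \<open>A \<times> L\<close>, so a difference is evaluated by adding \<open>v\<close>
    back.\<close>
  have h_diff: "h (u - v) \<oplus>\<^bsub>M\<^esub> h v = h u"
    if "Poly_Mapping.keys u \<subseteq> A \<times> carrier L" "Poly_Mapping.keys v \<subseteq> A \<times> carrier L" for u v
    using hom_mult[OF h(1), of "u - v" v] kd[OF that] that by simp
  have h_car: "h u \<in> carrier M" if "Poly_Mapping.keys u \<subseteq> A \<times> carrier L" for u
    using hom_in_carrier[OF h(1), of u] that by simp
  have h_zero: "h (u - v) = \<zero>\<^bsub>M\<^esub>"
    if "Poly_Mapping.keys u \<subseteq> A \<times> carrier L" "Poly_Mapping.keys v \<subseteq> A \<times> carrier L" "h u = h v" for u v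
    using h_diff[OF that(1,2)] that(3) h_car[OF that(2)] h_car[OF kd[OF that(1,2)]] by simp
  have "h q = \<zero>\<^bsub>M\<^esub>" if "q \<in> tensor_relators R ?A L" for q
    using that
  proof (cases rule: tensor_relatorsE)
    case (1 x y l)
    then obtain r where r: "r \<in> carrier R" "l = ?J +> r" by (auto simp: Q)
    have "h (frag_of (x \<oplus>\<^bsub>M\<^esub> y, l)) = h (frag_of (x, l)) \<oplus>\<^bsub>M\<^esub> h (frag_of (y, l))"
      using 1 r by (simp add: h(2) f QI submodule_add[OF A] AM smult_r_distr)
    also have "\<dots> = h (frag_of (x, l) + frag_of (y, l))"
      using hom_mult[OF h(1), of "frag_of (x, l)" "frag_of (y, l)"] 1 by (simp add: keys_frag_of)
    finally have "h (frag_of (x \<oplus>\<^bsub>M\<^esub> y, l) - (frag_of (x, l) + frag_of (y, l))) = \<zero>\<^bsub>M\<^esub>"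
      using 1 keys_add[of "frag_of (x, l)" "frag_of (y, l)"]
      by (intro h_zero) (auto simp: keys_frag_of submodule_add[OF A])
    then show ?thesis using 1(1) by (simp add: diff_diff_eq)
  next
    case (2 x k l)
    then obtain r s where rs: "r \<in> carrier R" "k = ?J +> r" "s \<in> carrier R" "l = ?J +> s" by (auto simp: Q)
    have "h (frag_of (x, k \<oplus>\<^bsub>L\<^esub> l)) = h (frag_of (x, k)) \<oplus>\<^bsub>M\<^esub> h (frag_of (x, l))"
      using 2 rs by (simp add: h(2) f QI Q(4) AM smult_l_distr)
    also have "\<dots> = h (frag_of (x, k) + frag_of (x, l))"
      using hom_mult[OF h(1), of "frag_of (x, k)" "frag_of (x, l)"] 2 by (simp add: keys_frag_of)
    finally have "h (frag_of (x, k \<oplus>\<^bsub>L\<^esub> l) - (frag_of (x, k) + frag_of (x, l))) = \<zero>\<^bsub>M\<^esub>"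
      using 2 keys_add[of "frag_of (x, k)" "frag_of (x, l)"]
      by (intro h_zero) (auto simp: keys_frag_of)
    then show ?thesis using 2(1) by (simp add: diff_diff_eq)
  next
    case (3 a x l)
    then obtain r where r: "r \<in> carrier R" "l = ?J +> r" by (auto simp: Q)
    have "h (frag_of (a \<odot>\<^bsub>M\<^esub> x, l)) = h (frag_of (x, a \<odot>\<^bsub>L\<^esub> l))"
      using 3 r by (simp add: h(2) f QI Q(5) AM submodule_smult[OF A] smult_assoc)
    then have "h (frag_of (a \<odot>\<^bsub>M\<^esub> x, l) - frag_of (x, a \<odot>\<^bsub>L\<^esub> l)) = \<zero>\<^bsub>M\<^esub>"
      using 3 QI by (intro h_zero) (auto simp: keys_frag_of submodule_smult[OF A])
    then show ?thesis using 3(1) by simp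
  qed
  then have rel: "h ` tensor_relators R ?A L \<subseteq> {\<zero>\<^bsub>M\<^esub>}" by blast
  have "x = \<zero>\<^bsub>M\<^esub>" if x: "x \<in> A" "x \<in> radical_submodule R M" for x
  proof -
    have one: "?J +> \<one> \<in> carrier L" by (simp add: QI)
    \<comment> \<open>Cosets have type \<open>'a set\<close>, so purity is first carried over from
      modules on lists.\<close>
    have "pure_submodule_wrt TYPE('a set) R M A"
      by (rule pure_submodule_imp_wrt[OF right_module_axioms pure])
    then have "tensor_inclusion R M L \<in> mon (tensor R ?A L) (tensor R M L)"
      using L unfolding pure_submodule_wrt_def by blast
    then have "frag_of (x, ?J +> \<one>) \<in> tensor_null R ?A L"
      using MJ[OF x(2) one] x(1) one
      unfolding tensor_inclusion_mon_iff[OF A right_module_axioms L] by (simp add: keys_frag_of)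
    moreover have "subgroup {\<zero>\<^bsub>M\<^esub>} (add_monoid M)"
      using submodule.axioms(1)[OF zero_submodule] .
    \<comment> \<open>The value of \<open>h\<close> at \<open>x \<otimes> 1\<close> is
      \<open>x\<close> itself, so the vanishing of this tensor in \<open>A \<otimes> L\<close>
      forces \<open>x = 0\<close>.\<close>
    ultimately have "h (frag_of (x, ?J +> \<one>)) \<in> {\<zero>\<^bsub>M\<^esub>}"
      using A.tensor_null_hom[OF L M.a_group _ _ rel] h(1) by simp
    then show ?thesis
      using x(1) one AM smult_one by (simp add: h(2) f)
  qed
  then show ?thesis
    using submodule_zero[OF A] submodule_zero[OF radical_submodule_submodule] by blast
qed

end

section \<open>The equivalence of the three conditions\<close>

theorem proposition4:
  fixes R :: "('r, 'x) ring_scheme" and M :: "('r, 'm, 'y) module_scheme" and S' :: "'m set"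
  assumes "ring R" and "semilocal R" and "right_module R M"
    and "S' = simple_summand_sum R M"
  shows "(simple_direct_injective R M \<longleftrightarrow> fully_invariant R M S' \<and> pure_submodule R M S') \<and>
    (fully_invariant R M S' \<and> pure_submodule R M S' \<longleftrightarrow>
      (\<exists>N. internal_direct_sum R M S' N) \<and> fully_invariant R M S')"
proof -
  interpret right_module R M by fact
  note S' = assms(4)
  \<comment> \<open>Semilocality enters here. Condition (3) is the hub: (1) and (2) each reach it
    through the trivial intersection with \<open>MJ\<close>, and (3) returns to each of
    them.\<close>
  have summand: "\<exists>N. internal_direct_sum R M S' N" if "S' \<inter> radical_submodule R M = {\<zero>\<^bsub>M\<^esub>}"
    using semilocal_direct_summand[OF assms(2) simple_summand_sum_submodule] that
    unfolding S' direct_summand_def by blast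
  have "\<exists>N. internal_direct_sum R M S' N" "fully_invariant R M S'" if "simple_direct_injective R M"
    using that summand simple_direct_injective_imp_radical simple_direct_injective_imp_fully_invariant
    unfolding S' by blast+
  moreover have "\<exists>N. internal_direct_sum R M S' N" if "pure_submodule R M S'"
    by (rule summand, rule pure_submodule_radical[OF that]) (simp add: S' simple_summand_sum_jacobson)
  moreover have "pure_submodule R M S'" if "internal_direct_sum R M S' N" for N
    by (rule direct_summand_pure[OF that])
  moreover have "simple_direct_injective R M" if "internal_direct_sum R M S' N" "fully_invariant R M S'" for N
    using fully_invariant_summand_imp_simple_direct_injective that unfolding S' by blast
  ultimately show ?thesis by blast
qed

end
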